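(* Consider Standpoint $\mathcal{EL}$ ($\mathbb{S}_{\mathcal{EL}}$) extended by a single distinguished rigid role name $\dot{R}$, i.e. only standpoint structures $\langle\Delta,\Pi,\sigma,\gamma\rangle$ with $\dot{R}^{\gamma(\pi)}=\dot{R}^{\gamma(\pi')}$ for all $\pi,\pi'\in\Pi$ are admitted. Then deciding satisfiability of knowledge bases is coNP-hard.
   Context: Syntax. A vocabulary consists of sets $N_{\mathsf{C}}$ (concept names), $N_{\mathsf{R}}$ (role names), $N_{\mathsf{I}}$ (individual names), $N_{\mathsf{S}}$ (standpoint names) with a distinguished $*\in N_{\mathsf{S}}$. Standpoint operators are $\Diamond_s$ and $\Box_s$ for $s\in N_{\mathsf{S}}$; $\odot_s$ stands for either. Concept terms: $C ::= \top \mid \bot \mid A \mid C_1\sqcap C_2 \mid \exists R.C \mid \odot_s[C]$ with $A\in N_{\mathsf{C}}$, $R\in N_{\mathsf{R}}$. A general concept inclusion (GCI) is $\odot_s[C\sqsubseteq D]$; a concept assertion is $\odot_s[C(a)]$; a role assertion is $\odot_s[R(a,b)]$; a sharpening statement is $s\preceq s'$. A knowledge base is a finite set of sharpening statements, GCIs, concept and role assertions. An axiom written without outer operator abbreviates one with outer operator $\Box_*$. Semantics. A standpoint structure is $\mathfrak{D}=\langle\Delta,\Pi,\sigma,\gamma\rangle$ with $\Delta\neq\emptyset$ a set (domain), $\Pi$ a set (precisifications), $\sigma$ a map from $N_{\mathsf{S}}$ to non-empty subsets of $\Pi$ with $\sigma( * )=\Pi$, and $\gamma$ assigning to each $\pi\in\Pi$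 an ordinary description logic interpretation over $\Delta$ ($A^{\gamma(\pi)}\subseteq\Delta$, $R^{\gamma(\pi)}\subseteq\Delta\times\Delta$, $a^{\gamma(\pi)}\in\Delta$), with $a^{\gamma(\pi)}=a^{\gamma(\pi')}=:a^{\mathfrak{D}}$ for all $\pi,\pi'\in\Pi$. Interpretations extend to concept terms by $\top^{\gamma(\pi)}=\Delta$, $\bot^{\gamma(\pi)}=\emptyset$, $(C\sqcap D)^{\gamma(\pi)}=C^{\gamma(\pi)}\cap D^{\gamma(\pi)}$, $(\exists R.C)^{\gamma(\pi)}=\{\delta\mid (\delta,\varepsilon)\in R^{\gamma(\pi)}\text{ for some }\varepsilon\in C^{\gamma(\pi)}\}$, $(\Diamond_s C)^{\gamma(\pi)}=\bigcup_{\pi'\in\sigma(s)}C^{\gamma(\pi')}$, $(\Box_s C)^{\gamma(\pi)}=\bigcap_{\pi'\in\sigma(s)}C^{\gamma(\pi')}$. Satisfaction: $\mathfrak{D}\models s\preceq s'$ iff $\sigma(s)\subseteq\sigma(s')$; $\mathfrak{D}\models\Box_s[C\sqsubseteq D]$ (resp. $\Diamond_s[C\sqsubseteq D]$) iff $C^{\gamma(\pi)}\subseteq D^{\gamma(\pi)}$ for all (resp. some) $\pi\in\sigma(s)$; $\mathfrak{D}\models\Box_s[C(a)]$ (resp. $\Diamond_s[C(a)]$) iff $a^{\mathfrak{D}}\in C^{\gamma(\pi)}$ for all (resp. some) $\pi\in\sigma(s)$; analogously for $\odot_s[R(a,b)]$ with $(a^{\mathfrak{D}},b^{\mathfrak{D}})\in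 R^{\gamma(\pi)}$. A knowledge base is satisfiable iff some (admitted) structure satisfies all its axioms. *)

theory Defs
  imports
    "HOL-Computational_Algebra.Polynomial"
    "HOL-Library.Countable_Set"
begin

section \<open>Standpoint EL: syntax\<close>

text \<open>Concept, role, individual and standpoint names each form a countably infinite supply,
  represented by the natural numbers. The universal standpoint and the distinguished rigid role
  are the respective names 0.\<close>

type_synonym cname = nat
type_synonym rname = nat
type_synonym iname = nat
type_synonym sname = nat

definition univ_sp :: sname where "univ_sp = 0"
definition rigid_role :: rname where "rigid_role = 0"

datatype modality = Dia | Box

datatype concept =
    Top
  | Bot
  | Atom cname
  | Conj concept concept
  | Ex rname concept
  | Mod modality sname concept

datatype axm =
    Sharp sname sname
  | GCI modality sname concept concept
  | CAssert modality sname concept iname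
  | RAssert modality sname rname iname iname

type_synonym kb = "axm set"


section \<open>Standpoint EL: semantics\<close>

record 'd interp =
  cint :: "cname \<Rightarrow> 'd set"
  rint :: "rname \<Rightarrow> ('d \<times> 'd) set"
  iint :: "iname \<Rightarrow> 'd"

record ('d, 'p) sp_struct =
  sdom :: "'d set"
  precs :: "'p set"
  sigma :: "sname \<Rightarrow> 'p set"
  gamma :: "'p \<Rightarrow> 'd interp"

definition is_interp :: "'d set \<Rightarrow> 'd interp \<Rightarrow> bool" where
  "is_interp \<Delta> I \<longleftrightarrow>
     (\<forall>A. cint I A \<subseteq> \<Delta>) \<and> (\<forall>R. rint I R \<subseteq> \<Delta> \<times> \<Delta>) \<and> (\<forall>a. iint I a \<in> \<Delta>)"

definition standpoint_structure :: "('d, 'p) sp_struct \<Rightarrow> bool" where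
  "standpoint_structure D \<longleftrightarrow>
     sdom D \<noteq> {} \<and>
     (\<forall>s. sigma D s \<noteq> {} \<and> sigma D s \<subseteq> precs D) \<and>
     sigma D univ_sp = precs D \<and>
     (\<forall>\<pi>\<in>precs D. is_interp (sdom D) (gamma D \<pi>)) \<and>
     (\<forall>\<pi>\<in>precs D. \<forall>\<pi>'\<in>precs D. \<forall>a. iint (gamma D \<pi>) a = iint (gamma D \<pi>') a)"

definition is_rigid :: "('d, 'p) sp_struct \<Rightarrow> rname \<Rightarrow> bool" where
  "is_rigid D R \<longleftrightarrow>
     (\<forall>\<pi>\<in>precs D. \<forall>\<pi>'\<in>precs D. rint (gamma D \<pi>) R = rint (gamma D \<pi>') R)"

definition admitted :: "('d, 'p) sp_struct \<Rightarrow> bool" where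
  "admitted D \<longleftrightarrow> standpoint_structure D \<and> is_rigid D rigid_role"

primrec ext :: "('d, 'p) sp_struct \<Rightarrow> concept \<Rightarrow> 'p \<Rightarrow> 'd set" where
  "ext D Top \<pi> = sdom D"
| "ext D Bot \<pi> = {}"
| "ext D (Atom A) \<pi> = cint (gamma D \<pi>) A"
| "ext D (Conj C1 C2) \<pi> = ext D C1 \<pi> \<inter> ext D C2 \<pi>"
| "ext D (Ex R C) \<pi> = {\<delta>. \<exists>\<epsilon>\<in>ext D C \<pi>. (\<delta>, \<epsilon>) \<in> rint (gamma D \<pi>) R}"
| "ext D (Mod m s C) \<pi> =
     (case m of Dia \<Rightarrow> (\<Union>\<pi>'\<in>sigma D s. ext D C \<pi>') | Box \<Rightarrow> (\<Inter>\<pi>'\<in>sigma D s. ext D C \<pi>'))"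

definition mod_quant :: "modality \<Rightarrow> 'p set \<Rightarrow> ('p \<Rightarrow> bool) \<Rightarrow> bool" where
  "mod_quant m S P = (case m of Dia \<Rightarrow> (\<exists>\<pi>\<in>S. P \<pi>) | Box \<Rightarrow> (\<forall>\<pi>\<in>S. P \<pi>))"

primrec sat_axm :: "('d, 'p) sp_struct \<Rightarrow> axm \<Rightarrow> bool" where
  "sat_axm D (Sharp s s') \<longleftrightarrow> sigma D s \<subseteq> sigma D s'"
| "sat_axm D (GCI m s C E) \<longleftrightarrow> mod_quant m (sigma D s) (\<lambda>\<pi>. ext D C \<pi> \<subseteq> ext D E \<pi>)"
| "sat_axm D (CAssert m s C a) \<longleftrightarrow>
     mod_quant m (sigma D s) (\<lambda>\<pi>. iint (gamma D \<pi>) a \<in> ext D C \<pi>)"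
| "sat_axm D (RAssert m s R a b) \<longleftrightarrow>
     mod_quant m (sigma D s)
       (\<lambda>\<pi>. (iint (gamma D \<pi>) a, iint (gamma D \<pi>) b) \<in> rint (gamma D \<pi>) R)"

definition sat_kb :: "('d, 'p) sp_struct \<Rightarrow> kb \<Rightarrow> bool" where
  "sat_kb D K \<longleftrightarrow> (\<forall>\<alpha>\<in>K. sat_axm D \<alpha>)"

text \<open>HOL cannot quantify existentially over types, so domain and precisifications are taken to
  be (possibly infinite) sets of natural numbers. This loses no models: see
  \<open>satisfiable_if_model\<close> below.\<close>

definition satisfiable :: "kb \<Rightarrow> bool" where
  "satisfiable K \<longleftrightarrow> (\<exists>D :: (nat, nat) sp_struct. admitted D \<and> sat_kb D K)"


subsection \<open>Adequacy of countable carriers\<close>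

instance modality :: countable by countable_datatype
instance concept :: countable by countable_datatype

lemma mod_quant_simps:
  "mod_quant Dia S P \<longleftrightarrow> (\<exists>\<pi>\<in>S. P \<pi>)"
  "mod_quant Box S P \<longleftrightarrow> (\<forall>\<pi>\<in>S. P \<pi>)"
  by (simp_all add: mod_quant_def)

lemma ext_subset_dom:
  assumes D: "standpoint_structure D" and p: "\<pi> \<in> precs D"
  shows "ext D C \<pi> \<subseteq> sdom D"
  using p
proof (induction C arbitrary: \<pi>)
  case (Atom A)
  then show ?case using D by (auto simp: standpoint_structure_def is_interp_def)
next
  case (Ex R C)
  then show ?case using D by (fastforce simp: standpoint_structure_def is_interp_def)
next
  case (Mod m s C)
  have "sigma D s \<noteq> {}" "sigma D s \<subseteq> precs D" using D by (auto simp: standpoint_structure_def)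
  then show ?case using Mod.IH by (cases m; simp; blast)
qed auto

lemma satisfiable_if_model:
  fixes D :: "('d, 'p) sp_struct"
  assumes adm: "admitted D" and K: "sat_kb D K"
  shows "satisfiable K"
proof -
  have D: "standpoint_structure D" and rig: "is_rigid D rigid_role"
    using adm by (auto simp: admitted_def)
  obtain d0 where d0: "d0 \<in> sdom D" using D by (auto simp: standpoint_structure_def)
  have sne: "sigma D s \<noteq> {}" and ssub: "sigma D s \<subseteq> precs D" for s
    using D by (auto simp: standpoint_structure_def)
  have sstar: "sigma D univ_sp = precs D" using D by (simp add: standpoint_structure_def)
  have idom: "iint (gamma D \<pi>) a \<in> sdom D" if "\<pi> \<in> precs D" for \<pi> a
    using D that unfolding standpoint_structure_def is_interp_def by blast
  have irig: "iint (gamma D \<pi>) a = iint (gamma D \<pi>') a"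
    if "\<pi> \<in> precs D" "\<pi>' \<in> precs D" for \<pi> \<pi>' a
    using D that unfolding standpoint_structure_def by blast
  obtain p0 where p0: "p0 \<in> precs D" using sne[of univ_sp] sstar by auto

  define Q where "Q \<delta> \<pi> R C \<epsilon> \<longleftrightarrow> \<epsilon> \<in> sdom D \<and> (\<pi> \<in> precs D \<and> \<delta> \<in> ext D (Ex R C) \<pi> \<longrightarrow>
      \<epsilon> \<in> ext D C \<pi> \<and> (\<delta>, \<epsilon>) \<in> rint (gamma D \<pi>) R)" for \<delta> \<pi> R C \<epsilon>
  have "\<exists>\<epsilon>. \<epsilon> \<in> sdom D \<and> (\<pi> \<in> precs D \<and> \<delta> \<in> ext D (Ex R C) \<pi> \<longrightarrow>
      \<epsilon> \<in> ext D C \<pi> \<and> (\<delta>, \<epsilon>) \<in> rint (gamma D \<pi>) R)" for \<delta> \<pi> R C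
    using ext_subset_dom[OF D, of \<pi> C] d0 by (cases "\<pi> \<in> precs D \<and> \<delta> \<in> ext D (Ex R C) \<pi>") auto
  then have fex: "\<exists>\<epsilon>. Q \<delta> \<pi> R C \<epsilon>" for \<delta> \<pi> R C unfolding Q_def .
  define f where "f \<delta> \<pi> R C = (SOME \<epsilon>. Q \<delta> \<pi> R C \<epsilon>)" for \<delta> \<pi> R C
  have Qf: "Q \<delta> \<pi> R C (f \<delta> \<pi> R C)" for \<delta> \<pi> R C
    unfolding f_def using fex by (rule someI_ex)
  have f: "\<And>\<delta> \<pi> R C. f \<delta> \<pi> R C \<in> sdom D"
    "\<And>\<delta> \<pi> R C. \<pi> \<in> precs D \<Longrightarrow> \<delta> \<in> ext D (Ex R C) \<pi> \<Longrightarrow>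
      f \<delta> \<pi> R C \<in> ext D C \<pi> \<and> (\<delta>, f \<delta> \<pi> R C) \<in> rint (gamma D \<pi>) R"
    using Qf unfolding Q_def by blast+
  have "\<exists>\<pi>. \<pi> \<in> sigma D s \<and> ((\<exists>\<pi>'\<in>sigma D s. \<delta> \<in> ext D C \<pi>') \<longrightarrow> \<delta> \<in> ext D C \<pi>)" for s \<delta> C
    using sne[of s] by blast
  then obtain g where g: "\<And>s \<delta> C. g s \<delta> C \<in> sigma D s"
    "\<And>s \<delta> C \<pi>'. \<pi>' \<in> sigma D s \<Longrightarrow> \<delta> \<in> ext D C \<pi>' \<Longrightarrow> \<delta> \<in> ext D C (g s \<delta> C)"
    by metis
  have "\<exists>\<pi>. \<pi> \<in> sigma D s \<and> ((\<exists>\<pi>'\<in>sigma D s. \<delta> \<notin> ext D C \<pi>') \<longrightarrow> \<delta> \<notin> ext D C \<pi>)" for s \<delta> C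
    using sne[of s] by blast
  then obtain h where h: "\<And>s \<delta> C. h s \<delta> C \<in> sigma D s"
    "\<And>s \<delta> C \<pi>'. \<pi>' \<in> sigma D s \<Longrightarrow> \<delta> \<notin> ext D C \<pi>' \<Longrightarrow> \<delta> \<notin> ext D C (h s \<delta> C)"
    by metis
  have "\<exists>\<pi>. \<pi> \<in> sigma D s \<and> ((\<exists>\<pi>'\<in>sigma D s. ext D C \<pi>' \<subseteq> ext D E \<pi>')
      \<longrightarrow> ext D C \<pi> \<subseteq> ext D E \<pi>)" for s C E
    using sne[of s] by blast
  then obtain u where u: "\<And>s C E. u s C E \<in> sigma D s"
    "\<And>s C E \<pi>'. \<pi>' \<in> sigma D s \<Longrightarrow> ext D C \<pi>' \<subseteq> ext D E \<pi>' \<Longrightarrow>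
      ext D C (u s C E) \<subseteq> ext D E (u s C E)"
    by metis
  define W where "W s R a b \<pi> \<longleftrightarrow>
      \<pi> \<in> sigma D s \<and> (iint (gamma D \<pi>) a, iint (gamma D \<pi>) b) \<in> rint (gamma D \<pi>) R" for s R a b \<pi>
  have "\<exists>\<pi>. \<pi> \<in> sigma D s \<and> ((\<exists>\<pi>'. W s R a b \<pi>') \<longrightarrow> W s R a b \<pi>)" for s R a b
    using sne[of s] unfolding W_def by blast
  then obtain v where v: "\<And>s R a b. v s R a b \<in> sigma D s"
    and vW: "\<And>s R a b \<pi>'. W s R a b \<pi>' \<Longrightarrow> W s R a b (v s R a b)"
    by metis

  define X0 where "X0 = insert d0 (range (iint (gamma D p0)))"
  define P0 where "P0 = range (\<lambda>(s, C, E). u s C E) \<union> range (\<lambda>(s, R, a, b). v s R a b)"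
  define F where "F = (\<lambda>(X :: 'd set, P :: 'p set).
     (X \<union> (\<lambda>(\<delta>, \<pi>, R, C). f \<delta> \<pi> R C) ` (X \<times> P \<times> UNIV \<times> UNIV),
      P \<union> (\<lambda>(s, \<delta>, C). g s \<delta> C) ` (UNIV \<times> X \<times> UNIV)
        \<union> (\<lambda>(s, \<delta>, C). h s \<delta> C) ` (UNIV \<times> X \<times> UNIV)))"
  define Z where "Z n = (F ^^ n) (X0, P0)" for n
  have Z0: "Z 0 = (X0, P0)" and ZS: "Z (Suc n) = F (Z n)" for n by (simp_all add: Z_def)
  define X where "X = (\<Union>n. fst (Z n))"
  define P where "P = (\<Union>n. snd (Z n))"
  have fstS: "fst (Z (Suc n)) = fst (Z n) \<union>
      (\<lambda>(\<delta>, \<pi>, R, C). f \<delta> \<pi> R C) ` (fst (Z n) \<times> snd (Z n) \<times> UNIV \<times> UNIV)" for n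
    by (simp add: ZS F_def split_beta)
  have sndS: "snd (Z (Suc n)) = snd (Z n) \<union> (\<lambda>(s, \<delta>, C). g s \<delta> C) ` (UNIV \<times> fst (Z n) \<times> UNIV)
        \<union> (\<lambda>(s, \<delta>, C). h s \<delta> C) ` (UNIV \<times> fst (Z n) \<times> UNIV)" for n
    by (simp add: ZS F_def split_beta)
  have inv: "countable (fst (Z n)) \<and> countable (snd (Z n)) \<and> fst (Z n) \<subseteq> sdom D \<and>
      snd (Z n) \<subseteq> precs D" for n
  proof (induction n)
    case 0
    have "countable X0" "countable P0" by (auto simp: X0_def P0_def)
    moreover have "X0 \<subseteq> sdom D" using d0 idom[OF p0] by (auto simp: X0_def)
    moreover have "P0 \<subseteq> precs D"
      using subsetD[OF ssub u(1)] subsetD[OF ssub v] by (auto simp: P0_def)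
    ultimately show ?case by (simp add: Z0)
  next
    case (Suc n)
    have "countable (fst (Z (Suc n)))"
      unfolding fstS using Suc by (intro countable_Un countable_image countable_SIGMA) auto
    moreover have "countable (snd (Z (Suc n)))"
      unfolding sndS using Suc by (intro countable_Un countable_image countable_SIGMA) auto
    moreover have "fst (Z (Suc n)) \<subseteq> sdom D" unfolding fstS using Suc f(1) by auto
    moreover have "snd (Z (Suc n)) \<subseteq> precs D"
      unfolding sndS using Suc subsetD[OF ssub g(1)] subsetD[OF ssub h(1)] by auto
    ultimately show ?case by blast
  qed
  have cX: "countable X" and cP: "countable P" unfolding X_def P_def using inv by auto
  have XD: "X \<subseteq> sdom D" and PD: "P \<subseteq> precs D" unfolding X_def P_def using inv by auto
  have monoX: "fst (Z m) \<subseteq> fst (Z n)" if "m \<le> n" for m n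
    using that by (rule lift_Suc_mono_le[rotated]) (auto simp: fstS)
  have monoP: "snd (Z m) \<subseteq> snd (Z n)" if "m \<le> n" for m n
    using that by (rule lift_Suc_mono_le[rotated]) (auto simp: sndS)
  have fX: "f \<delta> \<pi> R C \<in> X" if dX: "\<delta> \<in> X" and pP: "\<pi> \<in> P" for \<delta> \<pi> R C
  proof -
    obtain m n where "\<delta> \<in> fst (Z m)" "\<pi> \<in> snd (Z n)" using dX pP by (auto simp: X_def P_def)
    then have "\<delta> \<in> fst (Z (max m n))" "\<pi> \<in> snd (Z (max m n))"
      using monoX[of m "max m n"] monoP[of n "max m n"] by auto
    then have "f \<delta> \<pi> R C \<in> fst (Z (Suc (max m n)))"
      unfolding fstS by (intro UnI2 image_eqI[of _ _ "(\<delta>, \<pi>, R, C)"]) auto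
    then show ?thesis unfolding X_def by blast
  qed
  have gP: "g s \<delta> C \<in> P" and hP: "h s \<delta> C \<in> P" if dX: "\<delta> \<in> X" for s \<delta> C
  proof -
    obtain n where "\<delta> \<in> fst (Z n)" using dX by (auto simp: X_def)
    then have "g s \<delta> C \<in> snd (Z (Suc n))" "h s \<delta> C \<in> snd (Z (Suc n))"
      unfolding sndS by force+
    then show "g s \<delta> C \<in> P" "h s \<delta> C \<in> P" unfolding P_def by blast+
  qed
  have "P0 \<subseteq> P" using Z0 unfolding P_def by (metis UN_upper UNIV_I snd_conv)
  then have P0P: "\<pi> \<in> P0 \<Longrightarrow> \<pi> \<in> P" for \<pi> by blast
  have uP: "u s C E \<in> P" for s C E
    by (rule P0P, unfold P0_def, rule UnI1, rule range_eqI[of _ _ "(s, C, E)"]) simp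
  have vP: "v s R a b \<in> P" for s R a b
    by (rule P0P, unfold P0_def, rule UnI2, rule range_eqI[of _ _ "(s, R, a, b)"]) simp
  have X0X: "X0 \<subseteq> X" using Z0 unfolding X_def by (metis UN_upper UNIV_I fst_conv)
  then have d0X: "d0 \<in> X" and i0X: "iint (gamma D p0) a \<in> X" for a
    by (auto simp: X0_def)
  have iX: "iint (gamma D \<pi>) a \<in> X" if "\<pi> \<in> P" for \<pi> a
    using i0X irig[OF p0, of \<pi>] PD that by auto

  define t where "t = to_nat_on X"
  define q where "q = to_nat_on P"
  define q' where "q' = from_nat_into P"
  have tinj: "t \<delta> = t \<epsilon> \<longleftrightarrow> \<delta> = \<epsilon>" if "\<delta> \<in> X" "\<epsilon> \<in> X" for \<delta> \<epsilon>
    using cX that by (simp add: t_def)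
  have qq: "q' (q \<pi>) = \<pi>" if "\<pi> \<in> P" for \<pi>
    using cP that by (simp add: q_def q'_def)
  define I where "I = (\<lambda>J :: 'd interp. \<lparr> cint = (\<lambda>A. t ` (cint J A \<inter> X)),
      rint = (\<lambda>R. map_prod t t ` (rint J R \<inter> X \<times> X)), iint = (\<lambda>a. t (iint J a)) \<rparr>)"
  define N :: "(nat, nat) sp_struct" where "N = \<lparr> sdom = t ` X, precs = q ` P,
      sigma = (\<lambda>s. q ` (sigma D s \<inter> P)), gamma = (\<lambda>n. I (gamma D (q' n))) \<rparr>"
  have gam: "gamma N (q \<pi>) = I (gamma D \<pi>)" if "\<pi> \<in> P" for \<pi>
    using qq[OF that] by (simp add: N_def)
  have Ndom: "sdom N = t ` X" and Nprecs: "precs N = q ` P"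
    and Nsig: "sigma N s = q ` (sigma D s \<inter> P)" for s
    by (simp_all add: N_def)
  have Icint: "t \<delta> \<in> cint (I J) A \<longleftrightarrow> \<delta> \<in> cint J A" if "\<delta> \<in> X" for \<delta> J A
    using that tinj by (auto simp: I_def)
  have Irint: "(t \<delta>, t \<epsilon>) \<in> rint (I J) R \<longleftrightarrow> (\<delta>, \<epsilon>) \<in> rint J R"
    if "\<delta> \<in> X" "\<epsilon> \<in> X" for \<delta> \<epsilon> J R
    using that tinj by (auto simp: I_def)
  have Iiint: "iint (I J) a = t (iint J a)" for J a by (simp add: I_def)
  have sigP: "sigma D s \<inter> P \<noteq> {}" for s using gP[OF d0X] g(1) by blast
  have Nstd: "standpoint_structure N"
    unfolding standpoint_structure_def
  proof (intro conjI ballI allI)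
    show "sdom N \<noteq> {}" using d0X by (auto simp: Ndom)
    show "sigma N s \<noteq> {}" for s using sigP by (auto simp: Nsig)
    show "sigma N s \<subseteq> precs N" for s by (auto simp: Nsig Nprecs)
    show "sigma N univ_sp = precs N" using PD by (simp add: Nsig Nprecs sstar Int_absorb1)
  next
    fix n assume "n \<in> precs N"
    then obtain \<pi> where "\<pi> \<in> P" "n = q \<pi>" by (auto simp: Nprecs)
    then show "is_interp (sdom N) (gamma N n)"
      using iX by (auto simp: is_interp_def gam Ndom I_def)
  next
    fix n n' a assume "n \<in> precs N" "n' \<in> precs N"
    then obtain \<pi> \<pi>' where "\<pi> \<in> P" "n = q \<pi>" "\<pi>' \<in> P" "n' = q \<pi>'" by (auto simp: Nprecs)
    moreover from this have "iint (gamma D \<pi>) a = iint (gamma D \<pi>') a" using irig PD by blast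
    ultimately show "iint (gamma N n) a = iint (gamma N n') a" by (simp add: gam Iiint)
  qed
  have Nrig: "is_rigid N rigid_role"
    unfolding is_rigid_def
  proof (intro ballI)
    fix n n' assume "n \<in> precs N" "n' \<in> precs N"
    then obtain \<pi> \<pi>' where *: "\<pi> \<in> P" "n = q \<pi>" "\<pi>' \<in> P" "n' = q \<pi>'" by (auto simp: Nprecs)
    then have "rint (gamma D \<pi>) rigid_role = rint (gamma D \<pi>') rigid_role"
      using rig PD unfolding is_rigid_def by blast
    then show "rint (gamma N n) rigid_role = rint (gamma N n') rigid_role"
      using * by (simp add: gam I_def)
  qed
  have ext_N: "t \<delta> \<in> ext N C (q \<pi>) \<longleftrightarrow> \<delta> \<in> ext D C \<pi>" if "\<delta> \<in> X" "\<pi> \<in> P" for C \<delta> \<pi>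
    using that
  proof (induction C arbitrary: \<delta> \<pi>)
    case Top
    then show ?case using XD by (auto simp: Ndom)
  next
    case (Atom A)
    then show ?case by (simp add: gam Icint)
  next
    case (Ex R C)
    have q: "q \<pi> \<in> precs N" using Ex.prems by (auto simp: Nprecs)
    have sub: "ext N C (q \<pi>) \<subseteq> t ` X" using ext_subset_dom[OF Nstd q] by (simp add: Ndom)
    show ?case
    proof
      assume "t \<delta> \<in> ext N (Ex R C) (q \<pi>)"
      then obtain e where "e \<in> ext N C (q \<pi>)" "(t \<delta>, e) \<in> rint (gamma N (q \<pi>)) R" by auto
      moreover from this sub obtain \<epsilon> where "e = t \<epsilon>" "\<epsilon> \<in> X" by auto
      ultimately have "\<epsilon> \<in> ext D C \<pi>" "(\<delta>, \<epsilon>) \<in> rint (gamma D \<pi>) R"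
        using Ex Irint by (auto simp: gam)
      then show "\<delta> \<in> ext D (Ex R C) \<pi>" by auto
    next
      assume "\<delta> \<in> ext D (Ex R C) \<pi>"
      then have "f \<delta> \<pi> R C \<in> ext D C \<pi>" "(\<delta>, f \<delta> \<pi> R C) \<in> rint (gamma D \<pi>) R"
        using f(2) Ex.prems PD by blast+
      then have "t (f \<delta> \<pi> R C) \<in> ext N C (q \<pi>)"
        "(t \<delta>, t (f \<delta> \<pi> R C)) \<in> rint (gamma N (q \<pi>)) R"
        using Ex fX Irint by (auto simp: gam)
      then show "t \<delta> \<in> ext N (Ex R C) (q \<pi>)" by auto
    qed
  next
    case (Mod m s C)
    show ?case
    proof (cases m)
      case Dia
      have "t \<delta> \<in> ext N (Mod m s C) (q \<pi>) \<longleftrightarrow> (\<exists>\<pi>'\<in>sigma D s \<inter> P. \<delta> \<in> ext D C \<pi>')"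
        using Mod by (auto simp: Dia Nsig)
      also have "\<dots> \<longleftrightarrow> (\<exists>\<pi>'\<in>sigma D s. \<delta> \<in> ext D C \<pi>')"
        using g gP[OF Mod.prems(1)] by blast
      finally show ?thesis by (simp add: Dia)
    next
      case Box
      have "t \<delta> \<in> ext N (Mod m s C) (q \<pi>) \<longleftrightarrow> (\<forall>\<pi>'\<in>sigma D s \<inter> P. \<delta> \<in> ext D C \<pi>')"
        using Mod by (auto simp: Box Nsig)
      also have "\<dots> \<longleftrightarrow> (\<forall>\<pi>'\<in>sigma D s. \<delta> \<in> ext D C \<pi>')"
        using h hP[OF Mod.prems(1)] by blast
      finally show ?thesis by (simp add: Box)
    qed
  qed auto
  have sub_N: "ext N C (q \<pi>) \<subseteq> ext N E (q \<pi>)" if "\<pi> \<in> P" "ext D C \<pi> \<subseteq> ext D E \<pi>" for C E \<pi>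
  proof
    fix e assume e: "e \<in> ext N C (q \<pi>)"
    have "q \<pi> \<in> precs N" using that by (auto simp: Nprecs)
    then have "e \<in> t ` X" using ext_subset_dom[OF Nstd] e by (auto simp: Ndom)
    then show "e \<in> ext N E (q \<pi>)" using e ext_N that by auto
  qed
  have "sat_axm N \<alpha>" if "sat_axm D \<alpha>" for \<alpha>
  proof (cases \<alpha>)
    case (Sharp s s')
    then show ?thesis using that by (auto simp: Nsig)
  next
    case (GCI m s C E)
    show ?thesis
    proof (cases m)
      case Dia
      then have "ext D C (u s C E) \<subseteq> ext D E (u s C E)"
        using that u(2)[of _ s C E] by (simp add: GCI mod_quant_simps) blast
      then have "ext N C (q (u s C E)) \<subseteq> ext N E (q (u s C E))" using sub_N uP by blast
      then show ?thesis using u(1) uP by (auto simp: GCI Dia mod_quant_simps Nsig)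
    next
      case Box
      then show ?thesis using that sub_N by (fastforce simp: GCI mod_quant_simps Nsig)
    qed
  next
    case (CAssert m s C a)
    have *: "iint (gamma N (q \<pi>)) a \<in> ext N C (q \<pi>) \<longleftrightarrow> iint (gamma D \<pi>) a \<in> ext D C \<pi>"
      if "\<pi> \<in> P" for \<pi>
      using that ext_N iX by (simp add: gam Iiint)
    show ?thesis
    proof (cases m)
      case Dia
      let ?d = "iint (gamma D p0) a"
      obtain \<pi>' where \<pi>': "\<pi>' \<in> sigma D s" "iint (gamma D \<pi>') a \<in> ext D C \<pi>'"
        using \<open>sat_axm D \<alpha>\<close> by (auto simp: CAssert Dia mod_quant_simps)
      then have "?d \<in> ext D C \<pi>'" using irig[OF p0 subsetD[OF ssub \<pi>'(1)], of a] by simp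
      then have "?d \<in> ext D C (g s ?d C)" using g(2) \<pi>' by blast
      moreover have "?d = iint (gamma D (g s ?d C)) a" by (rule irig[OF p0 subsetD[OF ssub g(1)]])
      ultimately have "iint (gamma D (g s ?d C)) a \<in> ext D C (g s ?d C)" by simp
      then have "iint (gamma N (q (g s ?d C))) a \<in> ext N C (q (g s ?d C))"
        using * gP[OF i0X] by blast
      then show ?thesis using g(1) gP[OF i0X] by (auto simp: CAssert Dia mod_quant_simps Nsig)
    next
      case Box
      then show ?thesis using that * by (auto simp: CAssert mod_quant_simps Nsig)
    qed
  next
    case (RAssert m s R a b)
    have *: "(iint (gamma N (q \<pi>)) a, iint (gamma N (q \<pi>)) b) \<in> rint (gamma N (q \<pi>)) R \<longleftrightarrow>
        (iint (gamma D \<pi>) a, iint (gamma D \<pi>) b) \<in> rint (gamma D \<pi>) R" if "\<pi> \<in> P" for \<pi>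
      using that iX Irint by (simp add: gam Iiint)
    show ?thesis
    proof (cases m)
      case Dia
      let ?p = "v s R a b"
      have "(iint (gamma D ?p) a, iint (gamma D ?p) b) \<in> rint (gamma D ?p) R"
        using that vW[of s R a b] by (auto simp: RAssert Dia mod_quant_simps W_def)
      then show ?thesis using * v vP by (auto simp: RAssert Dia mod_quant_simps Nsig)
    next
      case Box
      then show ?thesis using that * by (auto simp: RAssert mod_quant_simps Nsig)
    qed
  qed
  then have "sat_kb N K" using K by (auto simp: sat_kb_def)
  then show ?thesis using Nstd Nrig by (auto simp: satisfiable_def admitted_def)
qed


section \<open>Knowledge bases as binary words\<close>

text \<open>Prefix notation; a name with index \<open>n\<close> is written as \<open>n\<close> ones followed by a zero.
  The resulting code is prefix-free, hence uniquely decodable.\<close>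

definition enc_name :: "nat \<Rightarrow> bool list" where
  "enc_name n = replicate n True @ [False]"

primrec enc_mod :: "modality \<Rightarrow> bool list" where
  "enc_mod Dia = [False]"
| "enc_mod Box = [True]"

primrec enc_concept :: "concept \<Rightarrow> bool list" where
  "enc_concept Top = [False, False, False]"
| "enc_concept Bot = [False, False, True]"
| "enc_concept (Atom A) = [False, True, False] @ enc_name A"
| "enc_concept (Conj C1 C2) = [False, True, True] @ enc_concept C1 @ enc_concept C2"
| "enc_concept (Ex R C) = [True, False, False] @ enc_name R @ enc_concept C"
| "enc_concept (Mod m s C) = [True, False, True] @ enc_mod m @ enc_name s @ enc_concept C"

primrec enc_axm :: "axm \<Rightarrow> bool list" where
  "enc_axm (Sharp s s') = [False, False] @ enc_name s @ enc_name s'"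
| "enc_axm (GCI m s C E) =
     [False, True] @ enc_mod m @ enc_name s @ enc_concept C @ enc_concept E"
| "enc_axm (CAssert m s C a) =
     [True, False] @ enc_mod m @ enc_name s @ enc_concept C @ enc_name a"
| "enc_axm (RAssert m s R a b) =
     [True, True] @ enc_mod m @ enc_name s @ enc_name R @ enc_name a @ enc_name b"

primrec enc_axms :: "axm list \<Rightarrow> bool list" where
  "enc_axms [] = [False]"
| "enc_axms (\<alpha> # \<alpha>s) = True # enc_axm \<alpha> @ enc_axms \<alpha>s"

lemma enc_name_prefix: "enc_name m @ u = enc_name n @ v \<Longrightarrow> m = n \<and> u = v"
  unfolding enc_name_def
proof (induction m arbitrary: n)
  case 0
  then show ?case by (cases n) auto
next
  case (Suc m)
  then show ?case by (cases n) auto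
qed

lemma enc_mod_prefix: "enc_mod m @ u = enc_mod n @ v \<Longrightarrow> m = n \<and> u = v"
  by (cases m; cases n) auto

lemma enc_concept_prefix: "enc_concept C @ u = enc_concept E @ v \<Longrightarrow> C = E \<and> u = v"
proof (induction C arbitrary: E u v)
  case Top
  then show ?case by (cases E) auto
next
  case Bot
  then show ?case by (cases E) auto
next
  case (Atom A)
  then show ?case by (cases E) (auto dest: enc_name_prefix)
next
  case (Conj C1 C2)
  show ?case
  proof (cases E)
    case (Conj E1 E2)
    then have "enc_concept C1 @ enc_concept C2 @ u = enc_concept E1 @ enc_concept E2 @ v"
      using Conj.prems by simp
    from Conj.IH(1)[OF this] show ?thesis using Conj.IH(2)[of u E2 v] Conj by simp
  qed (use Conj.prems in auto)
next
  case (Ex R C)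
  then show ?case by (cases E) (auto dest!: enc_name_prefix Ex.IH)
next
  case (Mod m s C)
  then show ?case by (cases E) (auto dest!: enc_mod_prefix enc_name_prefix Mod.IH)
qed

lemma enc_axm_prefix: "enc_axm \<alpha> @ u = enc_axm \<beta> @ v \<Longrightarrow> \<alpha> = \<beta> \<and> u = v"
  by (cases \<alpha>; cases \<beta>) (auto dest!: enc_mod_prefix enc_name_prefix enc_concept_prefix)

lemma inj_enc_axms: "inj enc_axms"
proof (rule injI)
  fix x y show "enc_axms x = enc_axms y \<Longrightarrow> x = y"
  proof (induction x arbitrary: y)
    case Nil
    then show ?case by (cases y) auto
  next
    case (Cons \<alpha> x)
    then show ?case by (cases y) (auto dest!: enc_axm_prefix)
  qed
qed

definition RIGID_EL_SAT :: "bool list set" where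
  "RIGID_EL_SAT = {enc_axms \<alpha>s | \<alpha>s. satisfiable (set \<alpha>s)}"


section \<open>Turing machines and complexity classes\<close>

text \<open>Nondeterministic multitape Turing machines with two-way infinite tapes. States and tape
  symbols are natural numbers; as the transition table is finite, only finitely many of them
  matter. State 0 is initial, state 1 is accepting; symbol 0 is the blank, symbols 1 and 2 stand
  for the input bits.\<close>

datatype move = MoveL | Stay | MoveR

record tm =
  ntapes :: nat
  trans :: "((nat \<times> nat list) \<times> (nat \<times> (nat \<times> move) list)) set"

definition wf_tm :: "tm \<Rightarrow> bool" where
  "wf_tm M \<longleftrightarrow> ntapes M \<ge> 1 \<and> finite (trans M) \<and>
     (\<forall>((q, rs), (q', as)) \<in> trans M. length rs = ntapes M \<and> length as = ntapes M)"

definition deterministic :: "tm \<Rightarrow> bool" where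
  "deterministic M \<longleftrightarrow> single_valued (trans M)"

type_synonym tape = "(int \<Rightarrow> nat) \<times> int"
type_synonym config = "nat \<times> tape list"

definition read_tape :: "tape \<Rightarrow> nat" where
  "read_tape t = fst t (snd t)"

primrec offset :: "move \<Rightarrow> int" where
  "offset MoveL = -1"
| "offset Stay = 0"
| "offset MoveR = 1"

definition act :: "nat \<times> move \<Rightarrow> tape \<Rightarrow> tape" where
  "act a t = ((fst t)(snd t := fst a), snd t + offset (snd a))"

definition step :: "tm \<Rightarrow> config \<Rightarrow> config \<Rightarrow> bool" where
  "step M c c' \<longleftrightarrow>
     (\<exists>as. ((fst c, map read_tape (snd c)), (fst c', as)) \<in> trans M \<and>
           snd c' = map2 act as (snd c))"

definition halted :: "tm \<Rightarrow> config \<Rightarrow> bool" where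
  "halted M c \<longleftrightarrow> (\<nexists>c'. step M c c')"

definition word_content :: "bool list \<Rightarrow> int \<Rightarrow> nat" where
  "word_content w i =
     (if 0 \<le> i \<and> i < int (length w) then (if w ! nat i then 2 else 1) else 0)"

definition init_config :: "tm \<Rightarrow> bool list \<Rightarrow> config" where
  "init_config M w = (0, (word_content w, 0) # replicate (ntapes M - 1) (word_content [], 0))"

definition nd_decides_in :: "tm \<Rightarrow> bool list set \<Rightarrow> (nat \<Rightarrow> nat) \<Rightarrow> bool" where
  "nd_decides_in M L T \<longleftrightarrow>
     (\<forall>w n c. (step M ^^ n) (init_config M w) c \<longrightarrow> n \<le> T (length w)) \<and>
     (\<forall>w. w \<in> L \<longleftrightarrow> (\<exists>c. (step M)\<^sup>*\<^sup>* (init_config M w) c \<and> halted M c \<and> fst c = 1))"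

text \<open>The output is read off the last tape of the halting configuration; the final head
  positions are irrelevant.\<close>

definition computes_in :: "tm \<Rightarrow> (bool list \<Rightarrow> bool list) \<Rightarrow> (nat \<Rightarrow> nat) \<Rightarrow> bool" where
  "computes_in M f T \<longleftrightarrow>
     (\<forall>w. \<exists>n c. n \<le> T (length w) \<and> (step M ^^ n) (init_config M w) c \<and> halted M c \<and>
                fst (last (snd c)) = word_content (f w))"

definition NP :: "bool list set set" where
  "NP = {L. \<exists>M (p :: nat poly). wf_tm M \<and> nd_decides_in M L (poly p)}"

definition coNP :: "bool list set set" where
  "coNP = {L. - L \<in> NP}"

definition polytime_computable :: "(bool list \<Rightarrow> bool list) \<Rightarrow> bool" where
  "polytime_computable f \<longleftrightarrow>
     (\<exists>M (p :: nat poly). wf_tm M \<and> deterministic M \<and> computes_in M f (poly p))"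

definition polytime_reducible :: "bool list set \<Rightarrow> bool list set \<Rightarrow> bool" where
  "polytime_reducible L L' \<longleftrightarrow> (\<exists>f. polytime_computable f \<and> (\<forall>w. w \<in> L \<longleftrightarrow> f w \<in> L'))"

definition coNP_hard :: "bool list set \<Rightarrow> bool" where
  "coNP_hard L' \<longleftrightarrow> (\<forall>L\<in>coNP. polytime_reducible L L')"

end

(* The complement of the given coNP language is accepted by a nondeterministic machine within a
   polynomial time bound p. In a model of the knowledge base every element has, along the rigid role,
   one child for each transition of the machine, so that below any element there is a rigid path
   labelled with any given sequence of transitions. Every element is moreover a leaf in some
   precisification. There the leaf carries the initial configuration, and existential restrictions
   push the computation up the path: a parent carries the result of applying the label of its child
   to the configuration of the child. A clash arises exactly if some computation accepts.
   Tape cells are named relative to the head; as information is lost at the ends of the named window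
   only at speed one, a window of width more than p suffices, and no clock is needed.

   Names are coded so that, apart from the symbol read from the input, the axioms for window
   position i depend on i only through blocks of F * i ones. So the encoded knowledge base is printed
   by a machine that keeps F * i in unary while it scans the input once and then runs through k
   nested loops of length n + 2 each. *)

theory Submission
  imports Defs
begin

section \<open>Compilation of while programs into deterministic multitape Turing machines\<close>

section \<open>Structured programs for multitape machines\<close>

datatype prog =
    Skip
  | Act nat "nat \<Rightarrow> nat" move
  | Seq prog prog
  | Cond nat nat prog prog
  | While nat prog

text \<open>The third argument is the exact number of steps of the compiled code. A test costs one
  step; the first branch of \<open>Cond\<close> pays one more for the jump over the second branch,
  and each round of \<open>While\<close> one for the jump back.\<close>

inductive exec :: "prog \<Rightarrow> (nat \<Rightarrow> tape) \<Rightarrow> nat \<Rightarrow> (nat \<Rightarrow> tape) \<Rightarrow> bool" where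
  exec_Skip: "exec Skip T 0 T"
| exec_Act: "exec (Act j h d) T 1 (T(j := act (h (read_tape (T j)), d) (T j)))"
| exec_Seq: "exec P T m T' \<Longrightarrow> exec Q T' n T'' \<Longrightarrow> exec (Seq P Q) T (m + n) T''"
| exec_Cond_True: "read_tape (T j) = s \<Longrightarrow> exec P T n T' \<Longrightarrow> exec (Cond j s P Q) T (Suc (n + 1)) T'"
| exec_Cond_False: "read_tape (T j) \<noteq> s \<Longrightarrow> exec Q T n T' \<Longrightarrow> exec (Cond j s P Q) T (Suc n) T'"
| exec_While_False: "read_tape (T j) = 0 \<Longrightarrow> exec (While j P) T 1 T"
| exec_While_True: "read_tape (T j) \<noteq> 0 \<Longrightarrow> exec P T m T' \<Longrightarrow> exec (While j P) T' n T'' \<Longrightarrow>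
    exec (While j P) T (Suc (m + Suc n)) T''"

primrec psize :: "prog \<Rightarrow> nat" where
  "psize Skip = 0"
| "psize (Act j h d) = 1"
| "psize (Seq P Q) = psize P + psize Q"
| "psize (Cond j s P Q) = psize P + psize Q + 2"
| "psize (While j P) = psize P + 2"

definition stay :: "nat list \<Rightarrow> (nat \<times> move) list" where
  "stay rs = map (\<lambda>r. (r, Stay)) rs"

text \<open>The code of \<open>P\<close> loaded at address \<open>a\<close> occupies the states from \<open>a\<close> up to but excluding
  \<open>a + psize P\<close> and leaves through the state \<open>a + psize P\<close>.\<close>

primrec delta :: "prog \<Rightarrow> nat \<Rightarrow> nat \<Rightarrow> nat list \<Rightarrow> nat \<times> (nat \<times> move) list" where
  "delta Skip a q rs = (a, stay rs)"
| "delta (Act j h d) a q rs = (a + 1, (stay rs)[j := (h (rs ! j), d)])"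
| "delta (Seq P Q) a q rs =
     (if q < a + psize P then delta P a q rs else delta Q (a + psize P) q rs)"
| "delta (Cond j s P Q) a q rs =
     (if q = a then (if rs ! j = s then a + 1 else a + 2 + psize P, stay rs)
      else if q < a + 1 + psize P then delta P (a + 1) q rs
      else if q = a + 1 + psize P then (a + 2 + psize P + psize Q, stay rs)
      else delta Q (a + 2 + psize P) q rs)"
| "delta (While j P) a q rs =
     (if q = a then (if rs ! j = 0 then a + 2 + psize P else a + 1, stay rs)
      else if q < a + 1 + psize P then delta P (a + 1) q rs
      else (a, stay rs))"

text \<open>A program started on tapes over the symbols 0, 1, 2 stays within them, so a finite
  transition table over \<open>reads K\<close> suffices.\<close>

primrec wf_prog :: "nat \<Rightarrow> prog \<Rightarrow> bool" where
  "wf_prog K Skip \<longleftrightarrow> True"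
| "wf_prog K (Act j h d) \<longleftrightarrow> j < K \<and> (\<forall>s<3. h s < 3)"
| "wf_prog K (Seq P Q) \<longleftrightarrow> wf_prog K P \<and> wf_prog K Q"
| "wf_prog K (Cond j s P Q) \<longleftrightarrow> j < K \<and> wf_prog K P \<and> wf_prog K Q"
| "wf_prog K (While j P) \<longleftrightarrow> j < K \<and> wf_prog K P"

definition reads :: "nat \<Rightarrow> nat list set" where
  "reads K = {rs. length rs = K \<and> set rs \<subseteq> {..<3}}"

text \<open>The exit state \<open>psize P\<close> gets no transition, so that leaving the program
  means halting.\<close>

definition machine :: "nat \<Rightarrow> prog \<Rightarrow> tm" where
  "machine K P = \<lparr>ntapes = K,
     trans = (\<lambda>(q, rs). ((q, rs), delta P 0 q rs)) ` ({..<psize P} \<times> reads K)\<rparr>"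

lemma finite_reads: "finite (reads K)"
proof -
  have "reads K = {rs. set rs \<subseteq> {..<3} \<and> length rs = K}" by (auto simp: reads_def)
  then show ?thesis by (simp add: finite_lists_length_eq)
qed

lemma length_delta: "length (snd (delta P a q rs)) = length rs"
  by (induction P arbitrary: a) (auto simp: stay_def)

lemma wf_machine: "K \<ge> 1 \<Longrightarrow> wf_tm (machine K P)"
  unfolding wf_tm_def machine_def using finite_reads
  by (auto simp: reads_def length_delta dest!: arg_cong[where f = snd])

lemma deterministic_machine: "deterministic (machine K P)"
  unfolding deterministic_def machine_def
  by (auto simp: single_valued_def prod_eq_iff dest: sym)

definition ternary :: "nat \<Rightarrow> (nat \<Rightarrow> tape) \<Rightarrow> bool" where
  "ternary K T \<longleftrightarrow> (\<forall>j<K. \<forall>x. fst (T j) x < 3)"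

lemma step_machine:
  assumes "q < psize P" "ternary K T"
    and "delta P 0 q (map (\<lambda>j. read_tape (T j)) [0..<K]) = (q', as)"
    and "map2 act as (map T [0..<K]) = map T' [0..<K]"
  shows "step (machine K P) (q, map T [0..<K]) (q', map T' [0..<K])"
proof -
  have "map (\<lambda>j. read_tape (T j)) [0..<K] \<in> reads K"
    using assms(2) by (auto simp: reads_def ternary_def read_tape_def)
  then have "((q, map (\<lambda>j. read_tape (T j)) [0..<K]), (q', as)) \<in> trans (machine K P)"
    using assms(1) by (auto simp: machine_def assms(3)[symmetric] image_iff)
  then show ?thesis using assms(4) by (auto simp: step_def comp_def)
qed

lemma act_stay: "map2 act (stay (map (\<lambda>j. read_tape (T j)) xs)) (map T xs) = map T xs"
  by (induction xs) (auto simp: stay_def act_def read_tape_def)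

lemma act_single:
  assumes "j < K"
  shows "map2 act ((stay (map (\<lambda>j. read_tape (T j)) [0..<K]))[j := a]) (map T [0..<K]) =
    map (T(j := act a (T j))) [0..<K]"
  using assms by (intro nth_equalityI) (auto simp: stay_def act_def read_tape_def nth_list_update)

lemma halted_machine: "psize P \<le> q \<Longrightarrow> halted (machine K P) (q, ts)"
  by (auto simp: halted_def step_def machine_def)

text \<open>The induction over \<open>exec\<close> enters subprograms; hence \<open>P\<close> is a
  piece of code at address \<open>a\<close> inside a larger program \<open>P0\<close>, whose
  transition function agrees with that of the piece on its own states. \<open>ternary\<close> is
  carried along because the table lists only ternary readings.\<close>

lemma machine_simulates:
  assumes "exec P T n T'" "wf_prog K P" "ternary K T"
    "\<And>q. a \<le> q \<Longrightarrow> q < a + psize P \<Longrightarrow> delta P0 0 q = delta P a q"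
    "a + psize P \<le> psize P0"
  shows "(step (machine K P0) ^^ n) (a, map T [0..<K]) (a + psize P, map T' [0..<K]) \<and> ternary K T'"
  using assms
proof (induction arbitrary: a rule: exec.induct)
  case (exec_Skip T)
  then show ?case by simp
next
  case (exec_Act j h d T)
  have "step (machine K P0) (a, map T [0..<K])
      (a + 1, map (T(j := act (h (read_tape (T j)), d) (T j))) [0..<K])"
    using exec_Act by (intro step_machine[OF _ _ _ act_single]) auto
  moreover have "ternary K (T(j := act (h (read_tape (T j)), d) (T j)))"
    using exec_Act by (auto simp: ternary_def act_def read_tape_def)
  ultimately show ?case by (simp only: relpowp_1 psize.simps simp_thms)
next
  case (exec_Seq P T m T' Q n T'')
  have 1: "(step (machine K P0) ^^ m) (a, map T [0..<K]) (a + psize P, map T' [0..<K]) \<and> ternary K T'"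
    using exec_Seq.prems by (intro exec_Seq.IH(1)) auto
  have 2: "(step (machine K P0) ^^ n) (a + psize P, map T' [0..<K])
      (a + psize P + psize Q, map T'' [0..<K]) \<and> ternary K T''"
    using exec_Seq.prems 1 by (intro exec_Seq.IH(2)) auto
  show ?case using 1 2 by (auto simp: add.assoc intro: relpowp_trans)
next
  case (exec_Cond_True T j s P n T' Q)
  let ?b = "a + 1 + psize P" let ?e = "a + 2 + psize P + psize Q"
  have j: "j < K" using exec_Cond_True.prems by simp
  have 1: "step (machine K P0) (a, map T [0..<K]) (a + 1, map T [0..<K])"
    using exec_Cond_True j by (intro step_machine[OF _ _ _ act_stay]) auto
  have 2: "(step (machine K P0) ^^ n) (a + 1, map T [0..<K]) (a + 1 + psize P, map T' [0..<K])
      \<and> ternary K T'"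
    using exec_Cond_True.prems by (intro exec_Cond_True.IH) auto
  have 3: "step (machine K P0) (?b, map T' [0..<K]) (?e, map T' [0..<K])"
    using exec_Cond_True 2 by (intro step_machine[OF _ _ _ act_stay]) auto
  have "(step (machine K P0) ^^ (n + 1)) (a + 1, map T [0..<K]) (?e, map T' [0..<K])"
    using 2 3 by auto
  from relpowp_Suc_I2[of "step (machine K P0)", OF 1 this] show ?case using 2
    by (simp only: psize.simps add_ac)
next
  case (exec_Cond_False T j s Q n T' P)
  let ?b = "a + 2 + psize P"
  have j: "j < K" using exec_Cond_False.prems by simp
  have 1: "step (machine K P0) (a, map T [0..<K]) (?b, map T [0..<K])"
    using exec_Cond_False j by (intro step_machine[OF _ _ _ act_stay]) auto
  have 2: "(step (machine K P0) ^^ n) (?b, map T [0..<K]) (?b + psize Q, map T' [0..<K])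
      \<and> ternary K T'"
    using exec_Cond_False.prems by (intro exec_Cond_False.IH) auto
  from relpowp_Suc_I2[of "step (machine K P0)", OF 1 2[THEN conjunct1]] show ?case using 2
    by (simp only: psize.simps add_ac)
next
  case (exec_While_False T j P)
  have j: "j < K" using exec_While_False.prems by simp
  have 1: "step (machine K P0) (a, map T [0..<K]) (a + 2 + psize P, map T [0..<K])"
    using exec_While_False j by (intro step_machine[OF _ _ _ act_stay]) auto
  then have "step (machine K P0) (a, map T [0..<K]) (a + psize (While j P), map T [0..<K])"
    by (simp only: psize.simps add_ac)
  then show ?case using exec_While_False by (simp only: relpowp_1 simp_thms)
next
  case (exec_While_True T j P m T' n T'')
  let ?b = "a + 1 + psize P"
  have j: "j < K" using exec_While_True.prems by simp
  have 1: "step (machine K P0) (a, map T [0..<K]) (a + 1, map T [0..<K])"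
    using exec_While_True j by (intro step_machine[OF _ _ _ act_stay]) auto
  have 2: "(step (machine K P0) ^^ m) (a + 1, map T [0..<K]) (?b, map T' [0..<K]) \<and> ternary K T'"
    using exec_While_True.prems by (intro exec_While_True.IH(1)) auto
  have 3: "step (machine K P0) (?b, map T' [0..<K]) (a, map T' [0..<K])"
    using exec_While_True 2 by (intro step_machine[OF _ _ _ act_stay]) auto
  have 4: "(step (machine K P0) ^^ n) (a, map T' [0..<K]) (a + psize (While j P), map T'' [0..<K])
      \<and> ternary K T''"
    using exec_While_True.prems 2 by (intro exec_While_True.IH(2)) auto
  have 5: "(step (machine K P0) ^^ Suc n) (?b, map T' [0..<K]) (a + psize (While j P), map T'' [0..<K])"
    by (rule relpowp_Suc_I2[of "step (machine K P0)", OF 3 4[THEN conjunct1]])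
  have 6: "(step (machine K P0) ^^ (m + Suc n)) (a + 1, map T [0..<K]) (a + psize (While j P), map T'' [0..<K])"
    by (rule relpowp_trans[OF 2[THEN conjunct1] 5])
  from relpowp_Suc_I2[of "step (machine K P0)", OF 1 6] 4 show ?case by blast
qed

definition runs :: "prog \<Rightarrow> (nat \<Rightarrow> tape) \<Rightarrow> nat \<Rightarrow> (nat \<Rightarrow> tape) \<Rightarrow> bool" where
  "runs P T t T' \<longleftrightarrow> (\<exists>n\<le>t. exec P T n T')"

lemma polytime_computable_prog:
  assumes wf: "wf_prog K P" and K: "K \<ge> 1"
    and run: "\<And>w. \<exists>T T'. runs P T (poly p (length w)) T' \<and>
      map T [0..<K] = (word_content w, 0) # replicate (K - 1) (word_content [], 0) \<and>
      fst (T' (K - 1)) = word_content (f w)"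
  shows "polytime_computable f"
proof -
  let ?M = "machine K P"
  have "\<exists>n c. n \<le> poly p (length w) \<and> (step ?M ^^ n) (init_config ?M w) c \<and> halted ?M c \<and>
          fst (last (snd c)) = word_content (f w)" for w
  proof -
    obtain T T' where r: "runs P T (poly p (length w)) T'"
      and T: "map T [0..<K] = (word_content w, 0) # replicate (K - 1) (word_content [], 0)"
      and T': "fst (T' (K - 1)) = word_content (f w)"
      using run[of w] by (elim exE conjE) (rule that)
    obtain n where n: "n \<le> poly p (length w)" and ex: "exec P T n T'"
      using r by (auto simp: runs_def)
    have init: "init_config ?M w = (0, map T [0..<K])"
      using T by (simp add: init_config_def machine_def)
    have "ternary K T"
      unfolding ternary_def
    proof (intro allI impI)
      fix j x assume "j < K"
      then have "T j \<in> set (map T [0..<K])" by auto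
      then have "T j = (word_content w, 0) \<or> T j = (word_content [], 0)"
        unfolding T by auto
      then show "fst (T j) x < 3" by (auto simp: word_content_def)
    qed
    then have "(step ?M ^^ n) (0, map T [0..<K]) (0 + psize P, map T' [0..<K])"
      using machine_simulates[OF ex wf, of 0 P] by simp
    moreover have "halted ?M (psize P, map T' [0..<K])" by (simp add: halted_machine)
    moreover have "fst (last (map T' [0..<K])) = word_content (f w)"
      using K T' by (simp add: last_map)
    ultimately show ?thesis using n init by (intro exI[of _ n] exI[of _ "(psize P, map T' [0..<K])"]) auto
  qed
  then show ?thesis
    unfolding polytime_computable_def computes_in_def
    using wf_machine[OF K, of P] deterministic_machine[of K P] by blast
qed


section \<open>Upper bounds on running times\<close>

lemma runs_mono: "runs P T t T' \<Longrightarrow> t \<le> t' \<Longrightarrow> runs P T t' T'"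
  unfolding runs_def using le_trans by blast

lemma runs_Skip: "runs Skip T 0 T"
  unfolding runs_def by (blast intro: exec_Skip)

lemma runs_Act: "T' = T(j := act (h (read_tape (T j)), d) (T j)) \<Longrightarrow> runs (Act j h d) T 1 T'"
  unfolding runs_def by (blast intro: exec_Act)

lemma runs_Seq: "runs P T m T' \<Longrightarrow> runs Q T' n T'' \<Longrightarrow> runs (Seq P Q) T (m + n) T''"
  unfolding runs_def by (blast intro: exec_Seq add_mono)

lemma runs_Cond:
  assumes "read_tape (T j) = s \<Longrightarrow> runs P T t T'" "read_tape (T j) \<noteq> s \<Longrightarrow> runs Q T t T'"
  shows "runs (Cond j s P Q) T (t + 2) T'"
proof (cases "read_tape (T j) = s")
  case True
  then obtain n where "n \<le> t" "exec P T n T'" using assms(1) by (auto simp: runs_def)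
  with True show ?thesis unfolding runs_def
    by (intro exI[of _ "Suc (n + 1)"]) (auto intro: exec_Cond_True[simplified])
next
  case False
  then obtain n where "n \<le> t" "exec Q T n T'" using assms(2) by (auto simp: runs_def)
  with False show ?thesis unfolding runs_def
    by (intro exI[of _ "Suc n"]) (auto intro: exec_Cond_False)
qed

lemma runs_While:
  assumes "\<And>i. i < m \<Longrightarrow> read_tape (S i j) \<noteq> 0 \<and> runs P (S i) t (S (Suc i))"
    and "read_tape (S m j) = 0"
  shows "runs (While j P) (S 0) (m * (t + 2) + 1) (S m)"
  using assms
proof (induction m arbitrary: S)
  case 0
  then show ?case unfolding runs_def by (intro exI[of _ 1] conjI) (auto intro: exec_While_False simp del: One_nat_def)
next
  case (Suc m)
  have "runs (While j P) (S (Suc 0)) (m * (t + 2) + 1) (S (Suc m))"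
    by (rule Suc.IH[of "\<lambda>i. S (Suc i)"]) (use Suc.prems in auto)
  then obtain n2 where n2: "n2 \<le> m * (t + 2) + 1" "exec (While j P) (S (Suc 0)) n2 (S (Suc m))"
    by (auto simp: runs_def)
  obtain n1 where n1: "n1 \<le> t" "exec P (S 0) n1 (S (Suc 0))"
    using Suc.prems(1)[of 0] by (auto simp: runs_def)
  have "exec (While j P) (S 0) (Suc (n1 + Suc n2)) (S (Suc m))"
    using Suc.prems(1)[of 0] n1 n2 by (intro exec_While_True) simp_all
  then show ?case unfolding runs_def using n1 n2
    by (intro exI[of _ "Suc (n1 + Suc n2)"]) auto
qed

definition seqs :: "prog list \<Rightarrow> prog" where
  "seqs Ps = foldr Seq Ps Skip"

lemma seqs_simps [simp]: "seqs [] = Skip" "seqs (P # Ps) = Seq P (seqs Ps)"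
  by (simp_all add: seqs_def)

lemma wf_seqs: "wf_prog K (seqs Ps) \<longleftrightarrow> (\<forall>P\<in>set Ps. wf_prog K P)"
  by (induction Ps) auto

lemma runs_seqs_tapes:
  assumes "\<And>T j. j \<in> set js \<Longrightarrow> T j = x \<Longrightarrow> runs (P j) T t (T(j := y))"
    and "distinct js" "\<And>j. j \<in> set js \<Longrightarrow> T j = x"
  shows "runs (seqs (map P js)) T (length js * t) (\<lambda>j. if j \<in> set js then y else T j)"
  using assms
proof (induction js arbitrary: T)
  case Nil
  then show ?case using runs_Skip by simp
next
  case (Cons j js)
  let ?T = "T(j := y)"
  have 1: "runs (P j) T t ?T" by (intro Cons.prems(1)) (use Cons.prems(3) in auto)
  have 2: "runs (seqs (map P js)) ?T (length js * t) (\<lambda>i. if i \<in> set js then y else ?T i)"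
    by (rule Cons.IH) (use Cons.prems in auto)
  have 3: "(\<lambda>i. if i \<in> set js then y else ?T i) = (\<lambda>i. if i \<in> set (j # js) then y else T i)"
    using Cons.prems by auto
  show ?case using runs_Seq[OF 1 2] unfolding 3 by simp
qed


section \<open>Head movements and loops driven by the content of a tape\<close>

subsection \<open>Walking along a tape\<close>

abbreviation bit :: "bool \<Rightarrow> nat" where
  "bit b \<equiv> (if b then 2 else 1)"

abbreviation word_tape :: "bool list \<Rightarrow> int \<Rightarrow> tape" where
  "word_tape w p \<equiv> (word_content w, p)"

abbreviation unary :: "nat \<Rightarrow> bool list" where
  "unary m \<equiv> replicate m True"

lemma word_content_snoc: "(word_content w)(int (length w) := bit b) = word_content (w @ [b])"
  by (rule ext) (auto simp: word_content_def nth_append)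

lemma word_content_nonblank: "0 < word_content w x \<longleftrightarrow> 0 \<le> x \<and> x < int (length w)"
  by (auto simp: word_content_def)

lemma act_move: "act (read_tape t, d) t = (fst t, snd t + offset d)"
  by (simp add: act_def read_tape_def)

abbreviation Move :: "nat \<Rightarrow> move \<Rightarrow> prog" where
  "Move j d \<equiv> Act j (\<lambda>s. s) d"

abbreviation Put :: "nat \<Rightarrow> bool \<Rightarrow> prog" where
  "Put j b \<equiv> Act j (\<lambda>_. bit b) MoveR"

lemma runs_Move: "T j = (u, p) \<Longrightarrow> runs (Move j d) T 1 (T(j := (u, p + offset d)))"
  by (rule runs_Act) (simp add: act_move)

lemma runs_Put:
  assumes "T j = word_tape w (int (length w))"
  shows "runs (Put j b) T 1 (T(j := word_tape (w @ [b]) (int (length (w @ [b])))))"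
proof -
  have "act (bit b, MoveR) (T j) = word_tape (w @ [b]) (int (length (w @ [b])))"
    by (simp add: act_def assms word_content_snoc[symmetric] del: fun_upd_apply)
  then show ?thesis by (intro runs_Act) simp
qed

text \<open>The first move is unconditional, since the head may stand on the blank behind the word;
  the loop then ends on the blank at position -1.\<close>

definition Rewind :: "nat \<Rightarrow> prog" where
  "Rewind j = Seq (Move j MoveL) (While j (Move j MoveL))"

lemma runs_Rewind:
  assumes "T j = word_tape w (int p)" "p \<le> length w"
  shows "runs (Rewind j) T (3 * p + 2) (T(j := word_tape w (-1)))"
proof -
  let ?S = "\<lambda>i. T(j := word_tape w (int p - 1 - int i))"
  have 1: "runs (Move j MoveL) T 1 (?S 0)"
    using runs_Move[of T j "word_content w" "int p" MoveL] assms(1) by simp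
  have "runs (While j (Move j MoveL)) (?S 0) (p * (1 + 2) + 1) (?S p)"
  proof (rule runs_While)
    fix i assume "i < p"
    then show "read_tape (?S i j) \<noteq> 0 \<and> runs (Move j MoveL) (?S i) 1 (?S (Suc i))"
      using runs_Move[of "?S i" j "word_content w" "int p - 1 - int i" MoveL] assms(2)
      by (auto simp: read_tape_def word_content_nonblank algebra_simps)
  qed (simp add: read_tape_def word_content_def)
  then have "runs (While j (Move j MoveL)) (?S 0) (p * (1 + 2) + 1) (T(j := word_tape w (-1)))"
    by simp
  from runs_Seq[OF 1 this] show ?thesis unfolding Rewind_def by (rule runs_mono) simp
qed

definition Forward :: "nat \<Rightarrow> prog" where
  "Forward j = Seq (Move j MoveR) (While j (Move j MoveR))"

lemma runs_Forward:
  assumes "T j = word_tape w (-1)"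
  shows "runs (Forward j) T (3 * length w + 2) (T(j := word_tape w (int (length w))))"
proof -
  let ?S = "\<lambda>i. T(j := word_tape w (int i))"
  have 1: "runs (Move j MoveR) T 1 (?S 0)"
    using runs_Move[of T j "word_content w" "-1" MoveR] assms(1) by simp
  have "runs (While j (Move j MoveR)) (?S 0) (length w * (1 + 2) + 1) (?S (length w))"
  proof (rule runs_While)
    fix i assume "i < length w"
    then show "read_tape (?S i j) \<noteq> 0 \<and> runs (Move j MoveR) (?S i) 1 (?S (Suc i))"
      using runs_Move[of "?S i" j "word_content w" "int i" MoveR]
      by (auto simp: read_tape_def word_content_nonblank algebra_simps)
  qed (simp add: read_tape_def word_content_def)
  from runs_Seq[OF 1 this] show ?thesis unfolding Forward_def by (rule runs_mono) simp
qed

text \<open>The word on tape \<open>j\<close> is a loop counter. Rewinding it at the end restores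
  the tape, which is what allows nesting.\<close>

definition Loop :: "nat \<Rightarrow> prog \<Rightarrow> prog" where
  "Loop j P = Seq (Move j MoveR) (Seq (While j (Seq P (Move j MoveR))) (Rewind j))"

lemma runs_Loop:
  assumes step: "\<And>i. i < length w \<Longrightarrow>
      runs P ((S i)(j := word_tape w (int i))) t ((S (Suc i))(j := word_tape w (int i)))"
    and S: "S 0 j = word_tape w (-1)" "S (length w) j = word_tape w (-1)"
  shows "runs (Loop j P) (S 0) (length w * (t + 6) + 4) (S (length w))"
proof -
  let ?S = "\<lambda>i. (S i)(j := word_tape w (int i))"
  have 1: "runs (Move j MoveR) (S 0) 1 (?S 0)"
    using runs_Move[of "S 0" j "word_content w" "-1" MoveR] S(1) by simp
  have 2: "runs (While j (Seq P (Move j MoveR))) (?S 0) (length w * ((t + 1) + 2) + 1) (?S (length w))"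
  proof (rule runs_While)
    fix i assume i: "i < length w"
    let ?T = "(S (Suc i))(j := word_tape w (int i))"
    have "runs (Move j MoveR) ?T 1 (?S (Suc i))"
      using runs_Move[of ?T j "word_content w" "int i" MoveR] by (simp add: add.commute)
    from runs_Seq[OF step[OF i] this] i
    show "read_tape (?S i j) \<noteq> 0 \<and> runs (Seq P (Move j MoveR)) (?S i) (t + 1) (?S (Suc i))"
      by (simp add: read_tape_def word_content_nonblank)
  qed (simp add: read_tape_def word_content_def)
  have 3: "runs (Rewind j) (?S (length w)) (3 * length w + 2) (S (length w))"
    using runs_Rewind[of "?S (length w)" j w "length w"] S(2) by (simp add: fun_upd_idem)
  from runs_Seq[OF 1 runs_Seq[OF 2 3]] show ?thesis
    unfolding Loop_def by (rule runs_mono) (simp add: algebra_simps)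
qed


section \<open>Printing words with holes for a unary number\<close>

subsection \<open>Printing templates\<close>

text \<open>\<open>Count\<close> is a hole filled at run time with a block of ones. As names are
  encoded in unary, the axioms of all window positions with the same input symbol are instances of
  one such word.\<close>

datatype token = Bits "bool list" | Count

primrec inst_token :: "nat \<Rightarrow> token \<Rightarrow> bool list" where
  "inst_token m (Bits u) = u"
| "inst_token m Count = unary m"

definition inst :: "nat \<Rightarrow> token list \<Rightarrow> bool list" where
  "inst m ts = concat (map (inst_token m) ts)"

text \<open>Tape \<open>1\<close> holds a number in unary, with the head on the blank to its left; tape \<open>r\<close> holds
  the output, with the head behind it.\<close>

definition counting :: "nat \<Rightarrow> (nat \<Rightarrow> tape) \<Rightarrow> nat \<Rightarrow> bool list \<Rightarrow> nat \<Rightarrow> tape" where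
  "counting r T m u = T(1 := word_tape (unary m) (-1), r := word_tape u (int (length u)))"

lemma counting_upd:
  assumes "r \<noteq> 1"
  shows "counting r T m u 1 = word_tape (unary m) (-1)"
    "counting r T m u r = word_tape u (int (length u))"
    "(counting r T m u)(1 := word_tape (unary m') (-1)) = counting r T m' u"
    "(counting r T m u)(r := word_tape v (int (length v))) = counting r T m v"
    "(counting r T m u)(1 := x, r := word_tape v (int (length v))) = (counting r T m v)(1 := x)"
  using assms by (auto simp: counting_def fun_eq_iff)

lemma runs_Put_counting:
  "r \<noteq> 1 \<Longrightarrow> runs (Put r b) (counting r T m u) 1 (counting r T m (u @ [b]))"
  using runs_Put[of "counting r T m u" r u b] by (simp add: counting_upd del: length_append)

primrec print_token :: "nat \<Rightarrow> token \<Rightarrow> prog" where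
  "print_token r (Bits u) = seqs (map (Put r) u)"
| "print_token r Count =
     Seq (Move 1 MoveR) (Seq (While 1 (Seq (Put r True) (Move 1 MoveR))) (Rewind 1))"

lemma runs_print_bits:
  "r \<noteq> 1 \<Longrightarrow> runs (seqs (map (Put r) v)) (counting r T m u) (length v) (counting r T m (u @ v))"
proof (induction v arbitrary: u)
  case Nil
  then show ?case using runs_Skip by simp
next
  case (Cons b v)
  show ?case
    using runs_Seq[OF runs_Put_counting[OF Cons.prems] Cons.IH[OF Cons.prems]] by simp
qed

lemma runs_print_count:
  assumes "r \<noteq> 1"
  shows "runs (print_token r Count) (counting r T m u) (7 * m + 4) (counting r T m (u @ unary m))"
proof -
  let ?S = "\<lambda>i. (counting r T m (u @ unary i))(1 := word_tape (unary m) (int i))"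
  have 1: "runs (Move 1 MoveR) (counting r T m u) 1 (?S 0)"
    using runs_Move[of "counting r T m u" 1 "word_content (unary m)" "-1" MoveR] assms
    by (simp add: counting_upd del: One_nat_def)
  have 2: "runs (While 1 (Seq (Put r True) (Move 1 MoveR))) (?S 0) (m * ((1 + 1) + 2) + 1) (?S m)"
  proof (rule runs_While)
    fix i assume i: "i < m"
    let ?T = "(counting r T m (u @ unary (Suc i)))(1 := word_tape (unary m) (int i))"
    have "(u @ unary i) @ [True] = u @ unary (Suc i)"
      by (simp add: replicate_append_same)
    then have "runs (Put r True) (?S i) 1 ?T"
      using runs_Put[of "?S i" r "u @ unary i" True] assms
      by (simp only: counting_upd[OF assms] fun_upd_other[OF assms] simp_thms True_implies_equals)
    moreover have "runs (Move 1 MoveR) ?T 1 (?S (Suc i))"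
      using runs_Move[of ?T 1 "word_content (unary m)" "int i" MoveR] by (simp add: add.commute)
    ultimately show "read_tape (?S i 1) \<noteq> 0 \<and>
        runs (Seq (Put r True) (Move 1 MoveR)) (?S i) (1 + 1) (?S (Suc i))"
      using i by (intro conjI runs_Seq) (auto simp: read_tape_def word_content_nonblank)
  qed (simp add: read_tape_def word_content_def)
  have 3: "runs (Rewind 1) (?S m) (3 * m + 2) (counting r T m (u @ unary m))"
    using runs_Rewind[of "?S m" 1 "unary m" m] assms
    by (simp add: counting_upd del: One_nat_def)
  from runs_Seq[OF 1 runs_Seq[OF 2 3]] show ?thesis
    unfolding print_token.simps by (rule runs_mono) simp
qed

definition print_tokens :: "nat \<Rightarrow> token list \<Rightarrow> prog" where
  "print_tokens r ts = seqs (map (print_token r) ts)"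

text \<open>The constant depends on the template, but not on \<open>m\<close>, the tapes or the
  output so far; this uniformity lets the times of all rounds be summed up.\<close>

lemma runs_print_tokens:
  assumes "r \<noteq> 1"
  shows "\<exists>A. \<forall>T m u. runs (print_tokens r ts) (counting r T m u) (A * (m + 1))
    (counting r T m (u @ inst m ts))"
proof (induction ts)
  case Nil
  have "runs (print_tokens r []) (counting r T m u) (0 * (m + 1)) (counting r T m (u @ inst m []))" for T m u
    using runs_Skip by (simp add: print_tokens_def inst_def)
  then show ?case by blast
next
  case (Cons x ts)
  then obtain A where A: "\<And>T m u. runs (print_tokens r ts) (counting r T m u) (A * (m + 1))
    (counting r T m (u @ inst m ts))" by blast
  have "\<exists>B. \<forall>T m u. runs (print_token r x) (counting r T m u) (B * (m + 1))
    (counting r T m (u @ inst_token m x))"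
  proof (cases x)
    case (Bits v)
    have "runs (print_token r x) (counting r T m u) (length v * (m + 1))
        (counting r T m (u @ inst_token m x))" for T m u
      unfolding Bits print_token.simps inst_token.simps
      by (rule runs_mono[OF runs_print_bits[OF assms]]) simp
    then show ?thesis by blast
  next
    case Count
    have "runs (print_token r x) (counting r T m u) (7 * (m + 1))
        (counting r T m (u @ inst_token m x))" for T m u
      unfolding Count inst_token.simps by (rule runs_mono[OF runs_print_count[OF assms]]) simp
    then show ?thesis by blast
  qed
  then obtain B where B: "\<And>T m u. runs (print_token r x) (counting r T m u) (B * (m + 1))
    (counting r T m (u @ inst_token m x))" by blast
  have "runs (print_tokens r (x # ts)) (counting r T m u) ((B + A) * (m + 1))
    (counting r T m (u @ inst m (x # ts)))" for T m u
    using runs_Seq[OF B A[of T m "u @ inst_token m x"]]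
    by (simp add: print_tokens_def inst_def algebra_simps del: print_token.simps)
  then show ?case by blast
qed

definition Add :: "nat \<Rightarrow> prog" where
  "Add F = Seq (Forward 1) (Seq (seqs (replicate F (Put 1 True))) (Rewind 1))"

lemma runs_Put_unary:
  assumes "T j = word_tape (unary m) (int m)"
  shows "runs (seqs (replicate F (Put j True))) T F
    (T(j := word_tape (unary (m + F)) (int (m + F))))"
  using assms
proof (induction F arbitrary: m T)
  case 0
  then show ?case using runs_Skip by (simp add: fun_upd_idem)
next
  case (Suc F)
  have "unary m @ [True] = unary (Suc m)" by (simp add: replicate_append_same)
  then have 1: "runs (Put j True) T 1 (T(j := word_tape (unary (Suc m)) (int (Suc m))))"
    using runs_Put[of T j "unary m" True] Suc.prems by simp
  have 2: "runs (seqs (replicate F (Put j True))) (T(j := word_tape (unary (Suc m)) (int (Suc m)))) F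
    (T(j := word_tape (unary (Suc m + F)) (int (Suc m + F))))"
    using Suc.IH[of "T(j := word_tape (unary (Suc m)) (int (Suc m)))" "Suc m"]
    by (simp only: fun_upd_upd fun_upd_same simp_thms True_implies_equals)
  show ?case using runs_Seq[OF 1 2] by (simp add: fun_upd_def)
qed

lemma runs_Add:
  assumes "r \<noteq> 1"
  shows "runs (Add F) (counting r T m u) (6 * m + 4 * F + 4) (counting r T (m + F) u)"
proof -
  let ?T = "\<lambda>i. (counting r T m u)(1 := word_tape (unary i) (int i))"
  have 1: "runs (Forward 1) (counting r T m u) (3 * m + 2) (?T m)"
    using runs_Forward[of "counting r T m u" 1 "unary m"] assms
    by (simp add: counting_upd del: One_nat_def)
  have 2: "runs (seqs (replicate F (Put 1 True))) (?T m) F (?T (m + F))"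
    using runs_Put_unary[of "?T m" 1 m F] by simp
  have 3: "runs (Rewind 1) (?T (m + F)) (3 * (m + F) + 2) (counting r T (m + F) u)"
    using runs_Rewind[of "?T (m + F)" 1 "unary (m + F)" "m + F"] assms
    by (simp add: counting_upd del: One_nat_def)
  from runs_Seq[OF 1 runs_Seq[OF 2 3]] show ?thesis
    unfolding Add_def by (rule runs_mono) simp
qed


text \<open>One round: with \<open>F * i\<close> on the counter, print for position \<open>i\<close>
  and advance to \<open>F * (i + 1)\<close>. Repeated addition replaces multiplication.\<close>

definition Emit :: "nat \<Rightarrow> nat \<Rightarrow> token list \<Rightarrow> prog" where
  "Emit r F ts = Seq (print_tokens r ts) (Add F)"

lemma runs_Emit:
  assumes "r \<noteq> 1"
  shows "\<exists>A. \<forall>T m u. runs (Emit r F ts) (counting r T m u) (A * (m + 1))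
    (counting r T (m + F) (u @ inst m ts))"
proof -
  obtain A where A: "\<And>T m u. runs (print_tokens r ts) (counting r T m u) (A * (m + 1))
    (counting r T m (u @ inst m ts))"
    using runs_print_tokens[OF assms] by blast
  have "runs (Emit r F ts) (counting r T m u) ((A + 4 * F + 10) * (m + 1))
    (counting r T (m + F) (u @ inst m ts))" for T m u
    using runs_Seq[OF A[of T m u] runs_Add[OF assms]] unfolding Emit_def
    by (rule runs_mono) (simp add: algebra_simps)
  then show ?thesis by blast
qed

text \<open>The loops run over the tapes \<open>2\<close> to \<open>l + 1\<close>. If these hold
  words of length \<open>m\<close>, then \<open>P\<close> runs \<open>m ^ l\<close> times, so a
  fixed program achieves polynomially many rounds.\<close>

primrec nest :: "prog \<Rightarrow> nat \<Rightarrow> prog" where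
  "nest P 0 = P"
| "nest P (Suc l) = Loop (l + 2) (nest P l)"

text \<open>\<open>u i\<close> is the output before round \<open>i\<close>, counted across all
  loops. The range from \<open>a\<close> to \<open>b\<close> restricts the body to the rounds for
  which the application can guarantee its output and the time bound \<open>t\<close>.\<close>

lemma runs_nest:
  assumes body: "\<And>T i. a \<le> i \<Longrightarrow> i < b \<Longrightarrow>
      runs P (counting r T (F * i) (u i)) t (counting r T (F * Suc i) (u (Suc i)))"
    and "v \<noteq> []" "l + 2 \<le> r" "a \<le> i" "i + length v ^ l \<le> b"
    and "\<And>j. 2 \<le> j \<Longrightarrow> j < l + 2 \<Longrightarrow> T j = word_tape v (-1)"
  shows "runs (nest P l) (counting r T (F * i) (u i)) (length v ^ l * (t + 10 * l))
    (counting r T (F * (i + length v ^ l)) (u (i + length v ^ l)))"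
  using assms(3-)
proof (induction l arbitrary: T i)
  case 0
  then show ?case using body[of i T] by simp
next
  case (Suc l)
  let ?m = "length v" let ?j = "l + 2"
  let ?S = "\<lambda>c. counting r T (F * (i + c * ?m ^ l)) (u (i + c * ?m ^ l))"
  have m: "1 \<le> ?m" using assms(2) by (simp add: Suc_le_eq)
  \<comment> \<open>The inner loops run while the head on tape \<open>?j\<close> is inside its word;
    that position is absorbed into \<open>T\<close>, for which the induction hypothesis is
    general.\<close>
  have upd: "(counting r T x y)(?j := z) = counting r (T(?j := z)) x y" for x y z
    using Suc.prems(1) by (auto simp: counting_def fun_eq_iff)
  have Sj: "?S c ?j = word_tape v (-1)" for c
    using Suc.prems by (simp add: counting_def)
  have "runs (Loop ?j (nest P l)) (?S 0) (?m * (?m ^ l * (t + 10 * l) + 6) + 4) (?S ?m)"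
  proof (rule runs_Loop[where S = ?S, OF _ Sj Sj])
    fix c assume c: "c < ?m"
    have "(c + 1) * ?m ^ l \<le> ?m * ?m ^ l" using c by (intro mult_right_mono) auto
    then have le: "i + c * ?m ^ l + ?m ^ l \<le> b" using Suc.prems(3) by simp
    have "runs (nest P l) (counting r (T(?j := word_tape v (int c))) (F * (i + c * ?m ^ l)) (u (i + c * ?m ^ l)))
      (?m ^ l * (t + 10 * l))
      (counting r (T(?j := word_tape v (int c))) (F * (i + c * ?m ^ l + ?m ^ l)) (u (i + c * ?m ^ l + ?m ^ l)))"
      by (rule Suc.IH) (use Suc.prems le in auto)
    then show "runs (nest P l) ((?S c)(?j := word_tape v (int c))) (?m ^ l * (t + 10 * l))
      ((?S (Suc c))(?j := word_tape v (int c)))"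
      unfolding upd by (simp add: algebra_simps)
  qed
  then have "runs (nest P (Suc l)) (?S 0) (?m * (?m ^ l * (t + 10 * l) + 6) + 4) (?S ?m)"
    by simp
  \<comment> \<open>One loop adds \<open>6 * ?m + 4\<close> steps, at most
    \<open>10 * ?m ^ Suc l\<close> because \<open>?m\<close> is positive; hence the allowance of 10
    per level.\<close>
  moreover have "?m * (?m ^ l * (t + 10 * l) + 6) + 4 \<le> ?m ^ Suc l * (t + 10 * Suc l)"
  proof -
    have "1 \<le> ?m ^ l" using m by simp
    then have "10 * ?m \<le> 10 * (?m * ?m ^ l)" by simp
    moreover have "6 * ?m + 4 \<le> 10 * ?m" using m by simp
    ultimately have "6 * ?m + 4 \<le> 10 * (?m * ?m ^ l)" by (rule order_trans[rotated])
    then show ?thesis by (simp add: algebra_simps)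
  qed
  ultimately show ?case by (auto elim: runs_mono)
qed


subsection \<open>Polynomial bounds\<close>

definition poly_bounded :: "(nat \<Rightarrow> nat) \<Rightarrow> bool" where
  "poly_bounded f \<longleftrightarrow> (\<exists>p :: nat poly. \<forall>n. f n \<le> poly p n)"

lemma poly_bounded_const: "poly_bounded (\<lambda>_. c)"
  unfolding poly_bounded_def by (rule exI[of _ "[:c:]"]) simp

lemma poly_bounded_id: "poly_bounded (\<lambda>n. n)"
  unfolding poly_bounded_def by (rule exI[of _ "[:0, 1:]"]) simp

lemma poly_bounded_add:
  assumes "poly_bounded f" "poly_bounded g"
  shows "poly_bounded (\<lambda>n. f n + g n)"
proof -
  obtain p q :: "nat poly" where "\<And>n. f n \<le> poly p n" "\<And>n. g n \<le> poly q n"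
    using assms unfolding poly_bounded_def by blast
  then show ?thesis unfolding poly_bounded_def by (intro exI[of _ "p + q"]) (simp add: add_mono)
qed

lemma poly_bounded_mult:
  assumes "poly_bounded f" "poly_bounded g"
  shows "poly_bounded (\<lambda>n. f n * g n)"
proof -
  obtain p q :: "nat poly" where "\<And>n. f n \<le> poly p n" "\<And>n. g n \<le> poly q n"
    using assms unfolding poly_bounded_def by blast
  then show ?thesis unfolding poly_bounded_def by (intro exI[of _ "p * q"]) (simp add: mult_mono)
qed

lemma poly_bounded_power: "poly_bounded f \<Longrightarrow> poly_bounded (\<lambda>n. f n ^ k)"
  by (induction k) (auto intro: poly_bounded_const poly_bounded_mult)

lemmas poly_bounded_intros =
  poly_bounded_const poly_bounded_id poly_bounded_add poly_bounded_mult poly_bounded_power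


section \<open>Polynomial-time printing with one template per window position\<close>

subsection \<open>Words assembled from a template per position\<close>

definition template_word ::
  "nat \<Rightarrow> bool list \<Rightarrow> (nat \<Rightarrow> token list) \<Rightarrow> bool list \<Rightarrow> nat \<Rightarrow> bool list" where
  "template_word F pre g w N =
     pre @ concat (map (\<lambda>i. inst (F * i) (g (word_content w (int i)))) [0..<N])"

lemma template_word_Suc:
  "template_word F pre g w (Suc N) =
     template_word F pre g w N @ inst (F * N) (g (word_content w (int N)))"
  by (simp add: template_word_def)

text \<open>Tape \<open>0\<close> holds the input, tape \<open>1\<close> the counter, tape
  \<open>k + 2\<close> the output. \<open>pad\<close> lengthens all loop words by one, twice in
  advance and once per input symbol, so that for an input of length \<open>n\<close> they get length
  \<open>n + 2\<close>. The scan prints the first \<open>n\<close> positions, the nested loops the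
  other \<open>(n + 2) ^ k\<close>, all of which read a blank.\<close>

definition template_prog ::
  "nat \<Rightarrow> nat \<Rightarrow> bool list \<Rightarrow> (nat \<Rightarrow> token list) \<Rightarrow> bool list \<Rightarrow> prog" where
  "template_prog k F pre g post =
    (let r = k + 2; loops = [2..<k + 2]; pad = seqs (map (\<lambda>j. Put j True) loops) in
     Seq (Move 1 MoveL) (Seq (print_tokens r [Bits pre]) (Seq pad (Seq pad (Seq
       (While 0 (Seq (Cond 0 2 (Emit r F (g 2)) (Emit r F (g 1))) (Seq pad (Move 0 MoveR))))
       (Seq (seqs (map Rewind loops)) (Seq (nest (Emit r F (g 0)) k)
         (print_tokens r [Bits post]))))))))"

lemma wf_nest: "k \<le> K - 2 \<Longrightarrow> 2 < K \<Longrightarrow> wf_prog K P \<Longrightarrow> wf_prog K (nest P k)"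
  by (induction k) (auto simp: Loop_def Rewind_def)

lemma wf_print_tokens: "1 < K \<Longrightarrow> r < K \<Longrightarrow> wf_prog K (print_tokens r ts)"
proof -
  assume "1 < K" "r < K"
  then have "wf_prog K (print_token r x)" for x
    by (cases x) (auto simp: wf_seqs Rewind_def)
  then show ?thesis by (auto simp: print_tokens_def wf_seqs)
qed

lemma wf_template_prog: "wf_prog (k + 3) (template_prog k F pre g post)"
proof -
  have "wf_prog (k + 3) (Emit (k + 2) F ts)" for ts
    using wf_print_tokens[of "k + 3" "k + 2" ts]
    by (auto simp: Emit_def Add_def Forward_def Rewind_def wf_seqs)
  then show ?thesis
    unfolding template_prog_def Let_def
    by (auto simp: wf_seqs Rewind_def intro!: wf_nest wf_print_tokens)
qed

text \<open>Tapes \<open>2, \<dots>, k + 1\<close> control one loop each. Their common content \<open>x\<close> is written during the scan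
  of the input on tape \<open>0\<close>.\<close>

definition workspace :: "nat \<Rightarrow> tape \<Rightarrow> tape \<Rightarrow> nat \<Rightarrow> tape" where
  "workspace k t x = (\<lambda>j. if j = 0 then t else if j < k + 2 then x else word_tape [] 0)"

lemma runs_loop_tapes:
  assumes "\<And>T j. T j = x \<Longrightarrow> runs (P j) T t (T(j := y))"
  shows "runs (seqs (map P [2..<k + 2])) (counting (k + 2) (workspace k z x) m u) (k * t)
    (counting (k + 2) (workspace k z y) m u)"
proof -
  let ?T = "counting (k + 2) (workspace k z x) m u"
  have 1: "runs (seqs (map P [2..<k + 2])) ?T (length [2..<k + 2] * t)
      (\<lambda>j. if j \<in> set [2..<k + 2] then y else ?T j)"
    by (rule runs_seqs_tapes) (use assms in \<open>auto simp: counting_def workspace_def\<close>)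
  have 2: "(\<lambda>j. if j \<in> set [2..<k + 2] then y else ?T j) =
      counting (k + 2) (workspace k z y) m u"
    by (auto simp: counting_def workspace_def fun_eq_iff)
  show ?thesis using 1 unfolding 2 by (simp only: length_upt diff_add_inverse2)
qed

theorem polytime_computable_template:
  "polytime_computable (\<lambda>w. template_word F pre g w (length w + (length w + 2) ^ k) @ post)"
proof -
  let ?r = "k + 2"
  have r: "?r \<noteq> 1" by simp
  obtain A1 where A1: "\<And>T m u. runs (print_tokens ?r [Bits pre]) (counting ?r T m u) (A1 * (m + 1))
    (counting ?r T m (u @ inst m [Bits pre]))" using runs_print_tokens[OF r] by blast
  obtain A2 where A2: "\<And>T m u. runs (print_tokens ?r [Bits post]) (counting ?r T m u) (A2 * (m + 1))
    (counting ?r T m (u @ inst m [Bits post]))" using runs_print_tokens[OF r] by blast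
  have "\<exists>B. \<forall>s. \<forall>T m u. runs (Emit ?r F (g s)) (counting ?r T m u) (B s * (m + 1))
    (counting ?r T (m + F) (u @ inst m (g s)))"
    by (rule choice) (use runs_Emit[OF r] in blast)
  then obtain B where B: "\<And>s T m u. runs (Emit ?r F (g s)) (counting ?r T m u) (B s * (m + 1))
    (counting ?r T (m + F) (u @ inst m (g s)))" by blast
  define A where "A = B 0 + B 1 + B 2"
  have E: "runs (Emit ?r F (g s)) (counting ?r T m u) (A * (m + 1))
    (counting ?r T (m + F) (u @ inst m (g s)))" if "s = 0 \<or> s = 1 \<or> s = 2" for s T m u
  proof -
    have "B s \<le> A" using that by (auto simp: A_def)
    then show ?thesis by (intro runs_mono[OF B] mult_right_mono) auto
  qed
  define N where "N n = n + (n + 2) ^ k" for n :: nat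
  \<comment> \<open>The counter never exceeds \<open>F * N n\<close>, so this bounds the time of
    every round.\<close>
  define \<tau> where "\<tau> n = A * (F * N n + 1)" for n
  define time where "time n = 1 + (A1 * 1 + (k * 1 + (k * 1 + ((n * ((\<tau> n + 2) + (k * 1 + 1) + 2) + 1) +
    (k * (3 * (n + 2) + 2) + ((n + 2) ^ k * (\<tau> n + 10 * k) + A2 * (F * N n + 1)))))))" for n
  have "poly_bounded time"
    unfolding time_def \<tau>_def N_def by (intro poly_bounded_intros)
  then obtain p :: "nat poly" where p: "\<And>n. time n \<le> poly p n" unfolding poly_bounded_def by blast
  define P where "P = template_prog k F pre g post"
  have "\<exists>T T'. runs P T (poly p (length w)) T' \<and>
      map T [0..<k + 3] = (word_content w, 0) # replicate (k + 3 - 1) (word_content [], 0) \<and>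
      fst (T' (k + 3 - 1)) = word_content (template_word F pre g w (length w + (length w + 2) ^ k) @ post)"
    for w
  proof -
    let ?n = "length w" let ?v = "unary (?n + 2)" let ?u = "template_word F pre g w"
    let ?T = "workspace k (word_tape w 0) (word_tape [] 0)"
    let ?pads = "\<lambda>i. word_tape (unary i) (int i)"
    let ?pad = "seqs (map (\<lambda>j. Put j True) [2..<k + 2])"
    let ?W = "workspace k"
    have put: "runs ?pad (counting ?r (?W z (?pads i)) m u) (k * 1) (counting ?r (?W z (?pads (Suc i))) m u)"
      for z i m u
    proof (rule runs_loop_tapes)
      fix T :: "nat \<Rightarrow> tape" and j assume "T j = ?pads i"
      then show "runs (Put j True) T 1 (T(j := ?pads (Suc i)))"
        using runs_Put[of T j "unary i" True] by (simp add: replicate_append_same)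
    qed
    have 1: "runs (Move 1 MoveL) ?T 1 (counting ?r ?T 0 [])"
    proof -
      have "?T(1 := word_tape [] (-1)) = counting ?r ?T 0 []"
        by (auto simp: counting_def workspace_def fun_eq_iff)
      then show ?thesis
        using runs_Move[of ?T 1 "word_content []" 0 MoveL] by (simp add: workspace_def)
    qed
    have 2: "runs (print_tokens ?r [Bits pre]) (counting ?r ?T 0 []) (A1 * 1)
        (counting ?r (?W (word_tape w 0) (?pads 0)) 0 (?u 0))"
      using A1[of ?T 0 "[]"] by (simp add: inst_def template_word_def)
    have 3: "runs ?pad (counting ?r (?W (word_tape w 0) (?pads 0)) 0 (?u 0)) (k * 1)
        (counting ?r (?W (word_tape w 0) (?pads (Suc 0))) 0 (?u 0))" by (rule put)
    let ?S = "\<lambda>i. counting ?r (?W (word_tape w (int i)) (?pads (i + 2))) (F * i) (?u i)"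
    have 4: "runs ?pad (counting ?r (?W (word_tape w 0) (?pads (Suc 0))) 0 (?u 0)) (k * 1) (?S 0)"
      using put[of "word_tape w 0" "Suc 0" 0 "?u 0"] by (simp add: numeral_2_eq_2)
    have 5: "runs (While 0 (Seq (Cond 0 2 (Emit ?r F (g 2)) (Emit ?r F (g 1))) (Seq ?pad (Move 0 MoveR))))
        (?S 0) (?n * ((\<tau> ?n + 2) + (k * 1 + 1) + 2) + 1) (?S ?n)"
    proof (rule runs_While)
      fix i assume i: "i < ?n"
      let ?T1 = "counting ?r (?W (word_tape w (int i)) (?pads (i + 2))) (F * Suc i) (?u (Suc i))"
      let ?T2 = "counting ?r (?W (word_tape w (int i)) (?pads (Suc (i + 2)))) (F * Suc i) (?u (Suc i))"
      have rd: "read_tape (?S i 0) = word_content w (int i)"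
        by (simp add: read_tape_def counting_def workspace_def)
      have s: "word_content w (int i) = 1 \<or> word_content w (int i) = 2"
        using i by (simp add: word_content_def)
      have "A * (F * i + 1) \<le> \<tau> ?n"
        using i unfolding \<tau>_def N_def by (intro mult_left_mono add_mono) auto
      then have em: "runs (Emit ?r F (g (word_content w (int i)))) (?S i) (\<tau> ?n) ?T1"
        using E[of "word_content w (int i)" "?W (word_tape w (int i)) (?pads (i + 2))" "F * i" "?u i"] s
        by (auto simp: template_word_Suc add.commute elim!: runs_mono)
      have c: "runs (Cond 0 2 (Emit ?r F (g 2)) (Emit ?r F (g 1))) (?S i) (\<tau> ?n + 2) ?T1"
      proof (rule runs_Cond)
        show "runs (Emit ?r F (g 2)) (?S i) (\<tau> ?n) ?T1" if "read_tape (?S i 0) = 2"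
          using em that unfolding rd by (simp only:)
        show "runs (Emit ?r F (g 1)) (?S i) (\<tau> ?n) ?T1" if "read_tape (?S i 0) \<noteq> 2"
          using em that s unfolding rd by (elim disjE) (simp_all only: refl not_True_eq_False)
      qed
      have mv: "runs (Move 0 MoveR) ?T2 1 (?S (Suc i))"
      proof -
        have "?T2(0 := word_tape w (int i + offset MoveR)) = ?S (Suc i)"
          by (auto simp: counting_def workspace_def fun_eq_iff add.commute)
        moreover have "?T2 0 = word_tape w (int i)" by (simp add: counting_def workspace_def)
        ultimately show ?thesis using runs_Move by metis
      qed
      show "read_tape (?S i 0) \<noteq> 0 \<and> runs (Seq (Cond 0 2 (Emit ?r F (g 2)) (Emit ?r F (g 1))) (Seq ?pad (Move 0 MoveR)))
          (?S i) ((\<tau> ?n + 2) + (k * 1 + 1)) (?S (Suc i))"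
        unfolding rd using s by (intro conjI runs_Seq[OF c runs_Seq[OF put mv]]) auto
    qed (simp add: read_tape_def counting_def workspace_def word_content_def)
    let ?H = "?W (word_tape w (int ?n)) (word_tape ?v (-1))"
    have 6: "runs (seqs (map Rewind [2..<k + 2])) (?S ?n) (k * (3 * (?n + 2) + 2))
        (counting ?r ?H (F * ?n) (?u ?n))"
    proof (rule runs_loop_tapes)
      fix T :: "nat \<Rightarrow> tape" and j assume "T j = ?pads (?n + 2)"
      then show "runs (Rewind j) T (3 * (?n + 2) + 2) (T(j := word_tape ?v (-1)))"
        by (rule runs_Rewind) simp
    qed
    have 7: "runs (nest (Emit ?r F (g 0)) k) (counting ?r ?H (F * ?n) (?u ?n)) ((?n + 2) ^ k * (\<tau> ?n + 10 * k))
        (counting ?r ?H (F * N ?n) (?u (N ?n)))"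
    proof -
      have "runs (nest (Emit ?r F (g 0)) k) (counting ?r ?H (F * ?n) (?u ?n)) (length ?v ^ k * (\<tau> ?n + 10 * k))
        (counting ?r ?H (F * (?n + length ?v ^ k)) (?u (?n + length ?v ^ k)))"
      proof (rule runs_nest[where a = ?n and b = "N ?n"])
        fix T i assume i: "?n \<le> i" "i < N ?n"
        have "A * (F * i + 1) \<le> \<tau> ?n"
          using i unfolding \<tau>_def by (intro mult_left_mono add_mono) auto
        moreover have "word_content w (int i) = 0" using i by (simp add: word_content_def)
        ultimately show "runs (Emit ?r F (g 0)) (counting ?r T (F * i) (?u i)) (\<tau> ?n)
            (counting ?r T (F * Suc i) (?u (Suc i)))"
          using E[of 0 T "F * i" "?u i"]
          by (auto simp: template_word_Suc add.commute elim!: runs_mono)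
      qed (auto simp: N_def workspace_def)
      then show ?thesis by (simp add: N_def)
    qed
    let ?T' = "counting ?r ?H (F * N ?n) (?u (N ?n) @ post)"
    have 8: "runs (print_tokens ?r [Bits post]) (counting ?r ?H (F * N ?n) (?u (N ?n))) (A2 * (F * N ?n + 1)) ?T'"
      using A2[of ?H "F * N ?n" "?u (N ?n)"] by (simp add: inst_def)
    have "runs P ?T (time ?n) ?T'"
      unfolding P_def template_prog_def Let_def time_def
      by (intro runs_Seq[OF 1 runs_Seq[OF 2 runs_Seq[OF 3 runs_Seq[OF 4 runs_Seq[OF 5
            runs_Seq[OF 6 runs_Seq[OF 7 8]]]]]]])
    then have "runs P ?T (poly p ?n) ?T'" using p by (rule runs_mono)
    moreover have "map ?T [0..<k + 3] = (word_content w, 0) # replicate (k + 3 - 1) (word_content [], 0)"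
      by (intro nth_equalityI) (auto simp: workspace_def nth_Cons split: nat.splits)
    moreover have "fst (?T' (k + 3 - 1)) = word_content (?u (?n + (?n + 2) ^ k) @ post)"
      by (simp add: counting_def N_def)
    ultimately show ?thesis by (intro exI[of _ ?T] exI[of _ ?T'] conjI)
  qed
  then show ?thesis
    unfolding P_def by (intro polytime_computable_prog[OF wf_template_prog]) auto
qed


section \<open>Knowledge bases describing the computations of a machine\<close>

section \<open>Nondeterministic computations in Standpoint EL with a rigid role\<close>

text \<open>Kinds of concept names. \<open>Ch j\<close> marks a child for transition
  \<open>j\<close>, \<open>Fire j\<close> a parent that carries the result of applying
  \<open>j\<close>, and \<open>Cell k b s\<close> a cell of tape \<open>k\<close> with symbol
  \<open>s\<close>, where \<open>b\<close> tells the side of the head; the distance is added by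
  \<open>nm\<close>.\<close>

datatype sym = Leaf | St nat | Ch nat | Fire nat | Cell nat bool nat

instance sym :: countable by countable_datatype

abbreviation gci :: "concept \<Rightarrow> concept \<Rightarrow> axm" where
  "gci \<equiv> GCI Box univ_sp"

lemma sat_gci:
  "standpoint_structure D \<Longrightarrow>
    sat_axm D (gci C E) \<longleftrightarrow> (\<forall>\<pi>\<in>precs D. ext D C \<pi> \<subseteq> ext D E \<pi>)"
  by (simp add: mod_quant_simps standpoint_structure_def)

definition conjs :: "concept list \<Rightarrow> concept" where
  "conjs Cs = foldr Conj Cs Top"

lemma ext_conjs: "v \<in> ext D (conjs Cs) \<pi> \<longleftrightarrow> v \<in> sdom D \<and> (\<forall>C\<in>set Cs. v \<in> ext D C \<pi>)"
  by (induction Cs) (auto simp: conjs_def)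

text \<open>Addressing cells relative to the head spares a record of its position: it is always at
  distance 0.\<close>

definition scan :: "config \<Rightarrow> nat \<Rightarrow> int \<Rightarrow> nat" where
  "scan c k z = fst (snd c ! k) (snd (snd c ! k) + z)"

lemma scan_0: "k < length (snd c) \<Longrightarrow> scan c k 0 = map read_tape (snd c) ! k"
  by (simp add: scan_def read_tape_def)

text \<open>After a move \<open>d\<close> the cell at distance \<open>z\<close> is the one formerly
  at \<open>z + offset d\<close>; the freshly written one was at 0.\<close>

lemma scan_act:
  assumes "k < length as" "k < length ts"
  shows "scan (q', map2 act as ts) k z =
    (if z + offset (snd (as ! k)) = 0 then fst (as ! k) else scan (q, ts) k (z + offset (snd (as ! k))))"
  using assms by (auto simp: scan_def act_def algebra_simps)

locale wf_machine =
  fixes M :: tm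
  assumes wf: "wf_tm M"
begin

abbreviation K :: nat where "K \<equiv> ntapes M"

definition trs :: "((nat \<times> nat list) \<times> nat \<times> (nat \<times> move) list) list" where
  "trs = (SOME ts. set ts = trans M)"

lemma set_trs: "set trs = trans M"
proof -
  have "finite (trans M)" using wf by (simp add: wf_tm_def)
  then have "\<exists>ts. set ts = trans M" by (rule finite_list)
  then show ?thesis unfolding trs_def by (rule someI_ex)
qed

abbreviation J :: nat where "J \<equiv> length trs"
abbreviation src :: "nat \<Rightarrow> nat" where "src j \<equiv> fst (fst (trs ! j))"
abbreviation rds :: "nat \<Rightarrow> nat list" where "rds j \<equiv> snd (fst (trs ! j))"
abbreviation tgt :: "nat \<Rightarrow> nat" where "tgt j \<equiv> fst (snd (trs ! j))"
abbreviation acts :: "nat \<Rightarrow> (nat \<times> move) list" where "acts j \<equiv> snd (snd (trs ! j))"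

lemma K_pos: "0 < K"
  using wf by (simp add: wf_tm_def)

lemma trs_in_trans: "j < J \<Longrightarrow> ((src j, rds j), (tgt j, acts j)) \<in> trans M"
  using set_trs nth_mem by fastforce

lemma length_trs: "j < J \<Longrightarrow> length (rds j) = K" "j < J \<Longrightarrow> length (acts j) = K"
  using wf trs_in_trans unfolding wf_tm_def by fastforce+

text \<open>A strict bound for states and tape symbols. The 2 is included since input bits may be
  absent from the transition table.\<close>

definition B :: nat where
  "B = Suc (Max ({2} \<union> (\<Union>((q, rs), (q', as))\<in>trans M. {q, q'} \<union> set rs \<union> fst ` set as)))"

lemma B_bound:
  assumes "((q, rs), (q', as)) \<in> trans M"
  shows "q < B" "q' < B" "\<And>s. s \<in> set rs \<Longrightarrow> s < B" "\<And>a d. (a, d) \<in> set as \<Longrightarrow> a < B"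
proof -
  let ?X = "{2} \<union> (\<Union>((q, rs), (q', as))\<in>trans M. {q, q'} \<union> set rs \<union> fst ` set as)"
  have "finite ?X" using wf by (auto simp: wf_tm_def)
  then have *: "x < B" if "x \<in> ?X" for x
    using that unfolding B_def by (intro le_imp_less_Suc Max_ge)
  show "q < B" "q' < B" using assms by (intro *; force)+
  show "\<And>s. s \<in> set rs \<Longrightarrow> s < B" using assms by (intro *; force)
  show "\<And>a d. (a, d) \<in> set as \<Longrightarrow> a < B" using assms by (intro *; force)
qed

lemma B_ge_3: "3 \<le> B"
proof -
  let ?X = "{2} \<union> (\<Union>((q, rs), (q', as))\<in>trans M. {q, q'} \<union> set rs \<union> fst ` set as)"
  have "finite ?X" using wf by (auto simp: wf_tm_def)
  then have "2 < B" unfolding B_def by (intro le_imp_less_Suc Max_ge) auto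
  then show ?thesis by simp
qed

lemma trs_bound:
  assumes "j < J"
  shows "src j < B" "tgt j < B" "k < K \<Longrightarrow> rds j ! k < B" "k < K \<Longrightarrow> fst (acts j ! k) < B"
  using B_bound[OF trs_in_trans[OF assms]] length_trs[OF assms]
  by (auto simp: prod.collapse) (metis nth_mem prod.collapse)


subsection \<open>The knowledge base\<close>

definition syms :: "sym set" where
  "syms = {Leaf} \<union> St ` {..<B} \<union> Ch ` {..<J} \<union> Fire ` {..<J} \<union>
     (\<lambda>(k, b, s). Cell k b s) ` ({..<K} \<times> UNIV \<times> {..<B})"

definition F :: nat where
  "F = Suc (Max (to_nat ` syms))"

text \<open>Symbol and position are remainder and quotient modulo \<open>F\<close>, so names do not
  collide, and in unary the position shows up as \<open>F * i\<close> ones.\<close>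

definition nm :: "sym \<Rightarrow> nat \<Rightarrow> cname" where
  "nm a i = to_nat a + F * i"

lemma nm_eq_iff:
  assumes "a \<in> syms" "b \<in> syms"
  shows "nm a i = nm b j \<longleftrightarrow> a = b \<and> i = j"
proof -
  have "finite syms" by (auto simp: syms_def)
  then have *: "to_nat x < F" if "x \<in> syms" for x
    using that unfolding F_def by (simp add: less_Suc_eq_le)
  have "a = b \<and> i = j" if "nm a i = nm b j"
  proof -
    have "to_nat a = nm a i mod F" "to_nat b = nm b j mod F"
      using assms[THEN *] by (simp_all add: nm_def)
    then have "to_nat a = to_nat b" using that by (simp only:)
    then have "a = b" by simp
    moreover have "i = j" using that \<open>a = b\<close> * assms unfolding nm_def by fastforce
    ultimately show ?thesis by simp
  qed
  then show ?thesis by auto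
qed

abbreviation atm :: "sym \<Rightarrow> concept" where
  "atm a \<equiv> Atom (nm a 0)"

definition cell :: "nat \<Rightarrow> int \<Rightarrow> nat \<Rightarrow> concept" where
  "cell k z s = Atom (nm (Cell k (0 \<le> z) s) (nat \<bar>z\<bar>))"

definition scans :: "nat list \<Rightarrow> concept" where
  "scans rs = conjs (map (\<lambda>k. cell k 0 (rs ! k)) [0..<K])"

text \<open>The child demanded for \<open>Ch j\<close> keeps this label in all precisifications, so
  that any of them can use it. Whether a configuration halts depends on its state and scanned
  symbols only, so finitely many axioms exclude the accepting halted ones.\<close>

definition control_axms :: "axm list" where
  "control_axms =
     [gci Top (Mod Dia univ_sp (atm Leaf)), gci (atm Leaf) (atm (St 0))] @
     concat (map (\<lambda>j.
       [gci Top (Ex rigid_role (atm (Ch j))),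
        gci (atm (Ch j)) (Mod Box univ_sp (atm (Ch j))),
        gci (Ex rigid_role (Conj (atm (Ch j)) (Conj (atm (St (src j))) (scans (rds j))))) (atm (Fire j)),
        gci (atm (Fire j)) (atm (St (tgt j)))]) [0..<J]) @
     map (\<lambda>rs. gci (Conj (atm (St 1)) (scans rs)) Bot)
       (filter (\<lambda>rs. (1, rs) \<notin> Domain (trans M)) (List.n_lists K [0..<B]))"

text \<open>The case split is that of \<open>scan_act\<close>: the transition determines the written
  cell, and every other one is copied from a child under its old distance.\<close>

definition shift_axms_for :: "int \<Rightarrow> nat \<Rightarrow> nat \<Rightarrow> axm list" where
  "shift_axms_for z j k =
     (let (a, d) = acts j ! k in
      if z + offset d = 0 then [gci (atm (Fire j)) (cell k z a)]
      else map (\<lambda>s. gci (Conj (atm (Fire j)) (Ex rigid_role (cell k (z + offset d) s))) (cell k z s))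
        [0..<B])"

definition shift_axms :: "int \<Rightarrow> axm list" where
  "shift_axms z = concat (map (\<lambda>j. concat (map (shift_axms_for z j) [0..<K])) [0..<J])"

definition init_axms :: "nat \<Rightarrow> int \<Rightarrow> axm list" where
  "init_axms s z = map (\<lambda>k. gci (atm Leaf) (cell k z (if k = 0 then s else 0))) [0..<K]"

definition fixed_axms :: "axm list" where
  "fixed_axms = control_axms @ shift_axms (-1) @ shift_axms 0 @ shift_axms 1"

text \<open>The initial cells at \<open>i\<close> and \<open>- (i + 1)\<close> together exhaust the
  integers; left of the input all is blank, hence the 0. The shift distances begin at 2 on either
  side because -1, 0 and 1 are treated in \<open>fixed_axms\<close>.\<close>

definition position_axms :: "nat \<Rightarrow> nat \<Rightarrow> axm list" where
  "position_axms s i = init_axms s (int i) @ init_axms 0 (- int (i + 1)) @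
     shift_axms (int (i + 2)) @ shift_axms (- int (i + 2))"

definition machine_kb :: "bool list \<Rightarrow> nat \<Rightarrow> axm list" where
  "machine_kb w N = fixed_axms @ concat (map (\<lambda>i. position_axms (word_content w (int i)) i) [0..<N])"

lemma set_machine_kb:
  "set (machine_kb w N) = set control_axms \<union> (\<Union>z\<in>{- int N - 1..int N + 1}. set (shift_axms z)) \<union>
     (\<Union>z\<in>{- int N..<int N}. set (init_axms (word_content w z) z))"
proof -
  have neg: "word_content w (- int (i + 1)) = 0" for i
    by (simp add: word_content_def)
  have 1: "{- int N - 1..int N + 1} = {-1, 0, 1} \<union> (\<lambda>i. int (i + 2)) ` {0..<N} \<union>
      (\<lambda>i. - int (i + 2)) ` {0..<N}" (is "?l = ?r")
  proof (intro equalityI subsetI)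
    fix z assume z: "z \<in> ?l"
    consider "z \<in> {-1, 0, 1}" | "z \<ge> 2" | "z \<le> -2" by force
    then show "z \<in> ?r"
    proof cases
      case 2
      then have "z = int (nat (z - 2) + 2)" "nat (z - 2) \<in> {0..<N}" using z by auto
      then show ?thesis by blast
    next
      case 3
      then have "z = - int (nat (- z - 2) + 2)" "nat (- z - 2) \<in> {0..<N}" using z by auto
      then show ?thesis by blast
    qed auto
  qed auto
  have 2: "{- int N..<int N} = int ` {0..<N} \<union> (\<lambda>i. - int (i + 1)) ` {0..<N}" (is "?l = ?r")
  proof (intro equalityI subsetI)
    fix z assume z: "z \<in> ?l"
    show "z \<in> ?r"
    proof (cases "z \<ge> 0")
      case True
      then have "z = int (nat z)" "nat z \<in> {0..<N}" using z by auto
      then show ?thesis by blast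
    next
      case False
      then have "z = - int (nat (- z - 1) + 1)" "nat (- z - 1) \<in> {0..<N}" using z by auto
      then show ?thesis by blast
    qed
  qed auto
  show ?thesis
    unfolding 1 2 machine_kb_def fixed_axms_def position_axms_def
    by (simp add: UN_Un Un_ac UN_Un_distrib neg[simplified] image_UN)
qed


section \<open>Every model exhibits all short computations\<close>

subsection \<open>From models to accepting computations\<close>

definition bounded :: "config \<Rightarrow> bool" where
  "bounded c \<longleftrightarrow> length (snd c) = K \<and> (\<forall>k<K. \<forall>z. scan c k z < B)"

lemma bounded_init: "bounded (init_config M w)"
  using K_pos B_ge_3
  by (auto simp: bounded_def scan_def init_config_def word_content_def nth_Cons split: nat.splits)

lemma stepE:
  assumes "step M c c'"
  obtains j where "j < J" "fst c = src j" "map read_tape (snd c) = rds j"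
    "c' = (tgt j, map2 act (acts j) (snd c))"
proof -
  obtain as where as: "((fst c, map read_tape (snd c)), (fst c', as)) \<in> trans M"
    "snd c' = map2 act as (snd c)" using assms by (auto simp: step_def)
  then obtain j where j: "j < J" "trs ! j = ((fst c, map read_tape (snd c)), (fst c', as))"
    using set_trs by (metis in_set_conv_nth)
  show ?thesis
    by (rule that[of j]) (simp_all add: j as(2) prod_eq_iff)
qed

lemma step_trs:
  assumes "j < J" "fst c = src j" "map read_tape (snd c) = rds j"
  shows "step M c (tgt j, map2 act (acts j) (snd c))"
  unfolding step_def
proof (intro exI conjI)
  show "((fst c, map read_tape (snd c)), fst (tgt j, map2 act (acts j) (snd c)), acts j) \<in> trans M"
    using trs_in_trans[OF assms(1)] unfolding assms(2,3) by simp
qed simp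

lemma scan_step:
  assumes "j < J" "length (snd c) = K" "k < K"
  shows "scan (tgt j, map2 act (acts j) (snd c)) k z =
    (let (a, d) = acts j ! k in if z + offset d = 0 then a else scan c k (z + offset d))"
  using scan_act[of k "acts j" "snd c" "tgt j" z "fst c"] assms length_trs[OF assms(1)]
  by (simp add: split_beta)

lemma bounded_step:
  assumes "step M c c'" "bounded c"
  shows "bounded c'"
proof -
  obtain j where j: "j < J" "c' = (tgt j, map2 act (acts j) (snd c))" using stepE[OF assms(1)] .
  have l: "length (snd c) = K" using assms by (simp add: bounded_def)
  then show ?thesis
    using assms(2) j length_trs[OF j(1)] trs_bound[OF j(1)] scan_step[OF j(1) l]
    by (auto simp: bounded_def split_beta)
qed

lemma bounded_reachable: "(step M ^^ t) (init_config M w) c \<Longrightarrow> bounded c"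
  by (induction t arbitrary: c) (auto intro: bounded_init bounded_step)

lemma gci_in_kb:
  "j < J \<Longrightarrow> gci Top (Ex rigid_role (atm (Ch j))) \<in> set control_axms"
  "j < J \<Longrightarrow> gci (atm (Ch j)) (Mod Box univ_sp (atm (Ch j))) \<in> set control_axms"
  "j < J \<Longrightarrow> gci (Ex rigid_role (Conj (atm (Ch j)) (Conj (atm (St (src j))) (scans (rds j)))))
     (atm (Fire j)) \<in> set control_axms"
  "j < J \<Longrightarrow> gci (atm (Fire j)) (atm (St (tgt j))) \<in> set control_axms"
  "gci Top (Mod Dia univ_sp (atm Leaf)) \<in> set control_axms"
  "gci (atm Leaf) (atm (St 0)) \<in> set control_axms"
  by (auto simp: control_axms_def)

text \<open>In any model every element \<open>v\<close> sees every computation of length below \<open>N\<close>: below \<open>v\<close> there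
  is a rigid path labelled with the transitions of that computation in reverse order, and the
  precisification in which its lower end is a leaf evaluates the computation up to \<open>v\<close>. As the tape
  window known at the leaf is finite, its valid part shrinks by one in each step.\<close>

lemma computation_visible:
  assumes D: "admitted D" and sat: "sat_kb D (set (machine_kb w N))"
    and "(step M ^^ t) (init_config M w) c" "t < N" "v \<in> sdom D"
  shows "\<exists>\<pi>\<in>precs D. v \<in> ext D (atm (St (fst c))) \<pi> \<and>
    (\<forall>k<K. \<forall>z. - int (N - t) \<le> z \<and> z < int (N - t) \<longrightarrow> v \<in> ext D (cell k z (scan c k z)) \<pi>)"
  using assms(3-)
proof (induction t arbitrary: c v)
  have S: "standpoint_structure D" and rig: "is_rigid D rigid_role"
    using D by (auto simp: admitted_def)
  have kb: "ext D C \<pi> \<subseteq> ext D E \<pi>" if "gci C E \<in> set (machine_kb w N)" "\<pi> \<in> precs D" for C E \<pi>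
    using sat that sat_gci[OF S] unfolding sat_kb_def by blast
  have sig: "sigma D univ_sp = precs D" using S by (simp add: standpoint_structure_def)
  {
    case 0
    have "v \<in> ext D (Mod Dia univ_sp (atm Leaf)) \<pi>" if "\<pi> \<in> precs D" for \<pi>
      using kb[OF _ that, of Top "Mod Dia univ_sp (atm Leaf)"] gci_in_kb(5) 0 by (auto simp: set_machine_kb)
    then obtain \<pi> where \<pi>: "\<pi> \<in> precs D" "v \<in> ext D (atm Leaf) \<pi>"
      using S unfolding standpoint_structure_def by (fastforce simp: sig)
    have c: "c = init_config M w" using 0 by simp
    have "v \<in> ext D (atm (St 0)) \<pi>"
      using kb[OF _ \<pi>(1), of "atm Leaf" "atm (St 0)"] gci_in_kb(6) \<pi>(2) by (auto simp: set_machine_kb)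
    moreover have "v \<in> ext D (cell k z (scan c k z)) \<pi>"
      if "k < K" "- int N \<le> z" "z < int N" for k z
    proof -
      have "scan c k z = (if k = 0 then word_content w z else 0)"
        using that by (auto simp: c scan_def init_config_def word_content_def nth_Cons split: nat.splits)
      then have "gci (atm Leaf) (cell k z (scan c k z)) \<in> set (init_axms (word_content w z) z)"
        using that by (auto simp: init_axms_def)
      then have "gci (atm Leaf) (cell k z (scan c k z)) \<in> set (machine_kb w N)"
        unfolding set_machine_kb using that by auto
      from kb[OF this \<pi>(1)] \<pi>(2) show ?thesis by blast
    qed
    ultimately show ?case using \<pi>(1) by (auto simp: c init_config_def)
  next
    case (Suc t)
    obtain c0 where c0: "(step M ^^ t) (init_config M w) c0" "step M c0 c" using Suc.prems by auto
    obtain j where j: "j < J" "fst c0 = src j" "map read_tape (snd c0) = rds j"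
      "c = (tgt j, map2 act (acts j) (snd c0))" using stepE[OF c0(2)] .
    have bd: "bounded c0" using bounded_reachable c0 by blast
    \<comment> \<open>The child is obtained in an arbitrary precisification, before the one that
      evaluates its computation is known. The boxed label and the rigidity of the role transport it
      to \<open>\<pi>\<close> afterwards.\<close>
    obtain \<pi>0 where \<pi>0: "\<pi>0 \<in> precs D"
      using S unfolding standpoint_structure_def by (metis all_not_in_conv)
    obtain v' where v': "v' \<in> ext D (atm (Ch j)) \<pi>0" "(v, v') \<in> rint (gamma D \<pi>0) rigid_role"
      using kb[OF _ \<pi>0, of Top "Ex rigid_role (atm (Ch j))"] gci_in_kb(1)[OF j(1)] Suc.prems
      by (auto simp: set_machine_kb)
    have ch: "v' \<in> ext D (atm (Ch j)) \<pi>" if "\<pi> \<in> precs D" for \<pi>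
      using kb[OF _ \<pi>0, of "atm (Ch j)" "Mod Box univ_sp (atm (Ch j))"] gci_in_kb(2)[OF j(1)] v' that
      by (auto simp: set_machine_kb sig)
    have "v' \<in> sdom D" using v' ext_subset_dom[OF S \<pi>0] by blast
    from Suc.IH[OF c0(1) _ this] Suc.prems obtain \<pi> where \<pi>: "\<pi> \<in> precs D"
      "v' \<in> ext D (atm (St (fst c0))) \<pi>"
      and cells: "\<And>k z. k < K \<Longrightarrow> - int (N - t) \<le> z \<Longrightarrow> z < int (N - t) \<Longrightarrow>
        v' \<in> ext D (cell k z (scan c0 k z)) \<pi>"
      by auto
    have R: "(v, v') \<in> rint (gamma D \<pi>) rigid_role"
      using rig v'(2) \<pi>0 \<pi>(1) unfolding is_rigid_def by blast
    have "v' \<in> ext D (scans (rds j)) \<pi>"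
      using \<open>v' \<in> sdom D\<close> cells[of _ 0] Suc.prems scan_0[of _ c0] bd
      by (auto simp: scans_def ext_conjs j bounded_def)
    then have fire: "v \<in> ext D (atm (Fire j)) \<pi>"
      using kb[OF _ \<pi>(1), of "Ex rigid_role (Conj (atm (Ch j)) (Conj (atm (St (src j))) (scans (rds j))))"
          "atm (Fire j)"] gci_in_kb(3)[OF j(1)] ch[OF \<pi>(1)] \<pi>(2) R j(2)
      by (auto simp: set_machine_kb)
    have "v \<in> ext D (atm (St (tgt j))) \<pi>"
      using kb[OF _ \<pi>(1), of "atm (Fire j)" "atm (St (tgt j))"] gci_in_kb(4)[OF j(1)] fire
      by (auto simp: set_machine_kb)
    moreover have "v \<in> ext D (cell k z (scan c k z)) \<pi>"
      if k: "k < K" and z: "- int (N - Suc t) \<le> z" "z < int (N - Suc t)" for k z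
    proof -
      obtain a d where ad: "acts j ! k = (a, d)" by fastforce
      have sc: "scan c k z = (if z + offset d = 0 then a else scan c0 k (z + offset d))"
        using scan_step[OF j(1), of c0 k z] bd k j(4) ad by (simp add: bounded_def)
      have shift: "x \<in> set (machine_kb w N)" if "x \<in> set (shift_axms_for z j k)" for x
      proof -
        have "x \<in> set (shift_axms z)" using that j(1) k
          by (simp add: shift_axms_def) (intro bexI[of _ j] bexI[of _ k]; simp)
        moreover have "z \<in> {- int N - 1..int N + 1}" using z by auto
        ultimately show ?thesis unfolding set_machine_kb by blast
      qed
      show ?thesis
      proof (cases "z + offset d = 0")
        case True
        then have "gci (atm (Fire j)) (cell k z (scan c k z)) \<in> set (machine_kb w N)"
          by (intro shift) (simp add: shift_axms_for_def ad sc)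
        from kb[OF this \<pi>(1)] fire show ?thesis by blast
      next
        case False
        have "scan c0 k (z + offset d) < B" using bd k by (simp add: bounded_def)
        then have "gci (Conj (atm (Fire j)) (Ex rigid_role (cell k (z + offset d) (scan c k z))))
            (cell k z (scan c k z)) \<in> set (machine_kb w N)"
          using False by (intro shift) (simp add: shift_axms_for_def ad sc)
        from kb[OF this \<pi>(1)] have *: "v \<in> ext D (Conj (atm (Fire j)) (Ex rigid_role (cell k (z + offset d) (scan c k z)))) \<pi> \<Longrightarrow> ?thesis" by blast
        \<comment> \<open>A move changes the distance by at most 1, so the cell lies in the window
          of the child, which is wider by 1 on each side.\<close>
        have "v' \<in> ext D (cell k (z + offset d) (scan c0 k (z + offset d))) \<pi>"
          using Suc.prems z by (intro cells k) (cases d; auto)+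
        then show ?thesis using fire R False by (intro *) (auto simp: sc)
      qed
    qed
    ultimately show ?case using \<pi>(1) j(4) by auto
  }
qed

text \<open>The final configuration is visible at every element; \<open>t < N\<close> keeps the
  scanned cells in the window, so its reading matches the left-hand side of a clash axiom.\<close>

lemma unsatisfiable_if_accepting:
  assumes "(step M ^^ t) (init_config M w) c" "halted M c" "fst c = 1" "t < N"
  shows "\<not> satisfiable (set (machine_kb w N))"
proof
  assume "satisfiable (set (machine_kb w N))"
  then obtain D :: "(nat, nat) sp_struct" where D: "admitted D" "sat_kb D (set (machine_kb w N))"
    unfolding satisfiable_def by blast
  then have S: "standpoint_structure D" by (simp add: admitted_def)
  then obtain v where "v \<in> sdom D" by (auto simp: standpoint_structure_def)
  from computation_visible[OF D assms(1,4) this] obtain \<pi> where \<pi>: "\<pi> \<in> precs D"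
    "v \<in> ext D (atm (St 1)) \<pi>" "\<And>k. k < K \<Longrightarrow> v \<in> ext D (cell k 0 (scan c k 0)) \<pi>"
    using assms(3,4) by auto
  have bd: "bounded c" using bounded_reachable assms(1) by blast
  let ?rs = "map read_tape (snd c)"
  have rs: "scan c k 0 = ?rs ! k" "?rs ! k < B" if "k < K" for k
    using that scan_0[of k c] bd unfolding bounded_def by metis+
  have "(1, ?rs) \<notin> Domain (trans M)"
  proof
    assume "(1, ?rs) \<in> Domain (trans M)"
    then obtain q as where "((1, ?rs), (q, as)) \<in> trans M" by auto
    then have "step M c (q, map2 act as (snd c))" using assms(3) by (auto simp: step_def)
    then show False using assms(2) by (auto simp: halted_def)
  qed
  moreover have "?rs \<in> set (List.n_lists K [0..<B])"
  proof -
    have "length ?rs = K" using bd by (simp add: bounded_def)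
    then have "\<forall>s\<in>set ?rs. s < B" using rs(2) by (metis in_set_conv_nth)
    then show ?thesis using \<open>length ?rs = K\<close> by (auto simp: set_n_lists)
  qed
  ultimately have "gci (Conj (atm (St 1)) (scans ?rs)) Bot \<in> set (machine_kb w N)"
    by (auto simp: set_machine_kb control_axms_def)
  then have "ext D (Conj (atm (St 1)) (scans ?rs)) \<pi> \<subseteq> {}"
    using D(2) sat_gci[OF S] \<pi>(1) unfolding sat_kb_def by (metis ext.simps(2))
  moreover have "v \<in> ext D (scans ?rs) \<pi>"
    using \<open>v \<in> sdom D\<close> \<pi>(3) rs(1) by (auto simp: scans_def ext_conjs)
  ultimately show False using \<pi>(2) by auto
qed


section \<open>A tree-shaped model for machines without accepting computation\<close>

subsection \<open>The tree of computations as a model\<close>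

definition apply_trans :: "nat \<Rightarrow> config \<Rightarrow> config option" where
  "apply_trans j c =
     (if j < J \<and> fst c = src j \<and> map read_tape (snd c) = rds j
      then Some (tgt j, map2 act (acts j) (snd c)) else None)"

text \<open>The last label is applied first, because computations start at the leaf and ascend. The
  value is \<open>None\<close> if some transition does not apply.\<close>

primrec run :: "bool list \<Rightarrow> nat list \<Rightarrow> config option" where
  "run w [] = Some (init_config M w)"
| "run w (j # u) = Option.bind (run w u) (apply_trans j)"

lemma run_reachable: "run w u = Some c \<Longrightarrow> (step M)\<^sup>*\<^sup>* (init_config M w) c \<and> length (snd c) = K"
proof (induction u arbitrary: c)
  case Nil
  then show ?case using K_pos by (auto simp: init_config_def)
next
  case (Cons j u)
  then obtain c0 where c0: "run w u = Some c0" "apply_trans j c0 = Some c"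
    by (auto simp: bind_eq_Some_conv)
  then have *: "j < J" "fst c0 = src j" "map read_tape (snd c0) = rds j"
    "c = (tgt j, map2 act (acts j) (snd c0))" by (auto simp: apply_trans_def split: if_splits)
  then have "step M c0 c" using step_trs by blast
  then show ?case using Cons.IH[OF c0(1)] * length_trs(2)[OF *(1)] by (auto intro: rtranclp.rtrancl_into_rtrancl)
qed

text \<open>An element \<open>v\<close> is the sequence of labels on the way down to it. In the precisification \<open>l\<close>, an
  element above the leaf \<open>l = v @ u\<close> carries the configuration that \<open>u\<close>, read from its end, leads to.\<close>

primrec holds :: "bool list \<Rightarrow> nat list \<Rightarrow> nat list \<Rightarrow> sym \<Rightarrow> nat \<Rightarrow> bool" where
  "holds w l v Leaf i \<longleftrightarrow> v = l"
| "holds w l v (St q) i \<longleftrightarrow> (\<exists>u c. l = v @ u \<and> run w u = Some c \<and> fst c = q)"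
| "holds w l v (Ch j) i \<longleftrightarrow> v \<noteq> [] \<and> last v = j"
| "holds w l v (Fire j) i \<longleftrightarrow> (\<exists>u c. l = v @ j # u \<and> run w (j # u) = Some c)"
| "holds w l v (Cell k b s) i \<longleftrightarrow>
     (\<exists>u c. l = v @ u \<and> run w u = Some c \<and> scan c k (if b then int i else - int i) = s)"

text \<open>Elements and precisifications are both lists of labels, and \<open>l\<close> as a
  precisification is the one in which the element \<open>l\<close> is a leaf. The tree edges are the
  same everywhere, which gives rigidity.\<close>

definition tree_model :: "bool list \<Rightarrow> (nat list, nat list) sp_struct" where
  "tree_model w = \<lparr>sdom = UNIV, precs = UNIV, sigma = (\<lambda>_. UNIV),
     gamma = (\<lambda>l. \<lparr>cint = (\<lambda>A. {v. \<exists>a\<in>syms. \<exists>i. A = nm a i \<and> holds w l v a i}),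
       rint = (\<lambda>_. {(v, v @ [j]) | v j. True}), iint = (\<lambda>_. [])\<rparr>)\<rparr>"

lemma tree_model_simps [simp]:
  "sdom (tree_model w) = UNIV" "precs (tree_model w) = UNIV" "sigma (tree_model w) s = UNIV"
  "rint (gamma (tree_model w) l) r = {(v, v @ [j]) | v j. True}"
  by (simp_all add: tree_model_def)

lemma admitted_tree_model: "admitted (tree_model w)"
  by (simp add: admitted_def standpoint_structure_def is_rigid_def is_interp_def tree_model_def)

lemma ext_nm: "a \<in> syms \<Longrightarrow> v \<in> ext (tree_model w) (Atom (nm a i)) l \<longleftrightarrow> holds w l v a i"
  by (auto simp: tree_model_def nm_eq_iff)

lemma ext_cell:
  assumes "k < K" "s < B"
  shows "v \<in> ext (tree_model w) (cell k z s) l \<longleftrightarrow>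
    (\<exists>u c. l = v @ u \<and> run w u = Some c \<and> scan c k z = s)"
proof -
  have "Cell k (0 \<le> z) s \<in> syms" using assms by (auto simp: syms_def image_iff)
  then show ?thesis unfolding cell_def by (simp add: ext_nm del: ext.simps)
qed

text \<open>Cancelling the prefix \<open>v\<close> shows that \<open>u\<close> is the only part
  below \<open>v\<close>, so \<open>v\<close> carries just the configuration
  \<open>c\<close>.\<close>

lemma ext_scans:
  assumes "length rs = K" "\<And>k. k < K \<Longrightarrow> rs ! k < B" "run w u = Some c"
  shows "v \<in> ext (tree_model w) (scans rs) (v @ u) \<longleftrightarrow> map read_tape (snd c) = rs"
proof -
  have l: "length (snd c) = K" using run_reachable[OF assms(3)] by simp
  have "v \<in> ext (tree_model w) (cell k 0 (rs ! k)) (v @ u) \<longleftrightarrow> scan c k 0 = rs ! k" if "k < K" for k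
    using assms(3) unfolding ext_cell[OF that assms(2)[OF that]] by (cases c) auto
  then have "v \<in> ext (tree_model w) (scans rs) (v @ u) \<longleftrightarrow> (\<forall>k<K. scan c k 0 = rs ! k)"
    by (auto simp: scans_def ext_conjs)
  also have "\<dots> \<longleftrightarrow> map read_tape (snd c) = rs"
    using l assms(1) scan_0[of _ c] by (auto simp: list_eq_iff_nth_eq)
  finally show ?thesis .
qed

lemma syms_intros:
  "Leaf \<in> syms" "q < B \<Longrightarrow> St q \<in> syms" "j < J \<Longrightarrow> Ch j \<in> syms" "j < J \<Longrightarrow> Fire j \<in> syms"
  by (auto simp: syms_def)

text \<open>The tree model works for every window size. The hypothesis enters at the clash axioms:
  an element in the left-hand side of one would carry a reachable accepting halted
  configuration.\<close>

lemma satisfiable_if_not_accepting: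
  assumes "\<nexists>c. (step M)\<^sup>*\<^sup>* (init_config M w) c \<and> halted M c \<and> fst c = 1"
  shows "satisfiable (set (machine_kb w N))"
proof (rule satisfiable_if_model[OF admitted_tree_model])
  let ?D = "tree_model w"
  have S: "standpoint_structure ?D" using admitted_tree_model by (simp add: admitted_def)
  have atm: "v \<in> ext ?D (atm a) l \<longleftrightarrow> holds w l v a 0" if "a \<in> syms" for v l a
    using ext_nm[OF that] .
  have gciI: "sat_axm ?D (gci C E)" if "\<And>v l. v \<in> ext ?D C l \<Longrightarrow> v \<in> ext ?D E l" for C E
    using that by (subst sat_gci[OF S]) auto
  have B01: "0 < B" "1 < B" using B_ge_3 by auto
  have fire: "\<exists>u c. l = v @ j # u \<and> run w u = Some c \<and> length (snd c) = K \<and>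
      run w (j # u) = Some (tgt j, map2 act (acts j) (snd c))"
    if "j < J" "v \<in> ext ?D (atm (Fire j)) l" for v l j
  proof -
    have "holds w l v (Fire j) 0" using that atm[OF syms_intros(4)[OF that(1)]] by (simp only:)
    then obtain u c' where u: "l = v @ j # u" "run w (j # u) = Some c'"
      unfolding holds.simps by blast
    then obtain c where c: "run w u = Some c" "apply_trans j c = Some c'"
      by (auto simp: bind_eq_Some_conv)
    then show ?thesis using u run_reachable[OF c(1)]
      by (intro exI[of _ u] exI[of _ c]) (auto simp: apply_trans_def split: if_splits)
  qed
  have control: "sat_axm ?D x" if x: "x \<in> set control_axms" for x
  proof -
    consider "x = gci Top (Mod Dia univ_sp (atm Leaf))" | "x = gci (atm Leaf) (atm (St 0))"
      | j where "j < J" "x = gci Top (Ex rigid_role (atm (Ch j)))"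
      | j where "j < J" "x = gci (atm (Ch j)) (Mod Box univ_sp (atm (Ch j)))"
      | j where "j < J" "x = gci (Ex rigid_role (Conj (atm (Ch j))
          (Conj (atm (St (src j))) (scans (rds j))))) (atm (Fire j))"
      | j where "j < J" "x = gci (atm (Fire j)) (atm (St (tgt j)))"
      | rs where "(1, rs) \<notin> Domain (trans M)" "rs \<in> set (List.n_lists K [0..<B])"
          "x = gci (Conj (atm (St 1)) (scans rs)) Bot"
      using x unfolding control_axms_def by auto
    then show ?thesis
    proof cases
      case 1
      \<comment> \<open>The precisification \<open>v\<close> is the witness: there \<open>v\<close>
        is the leaf.\<close>
      have "v \<in> ext ?D (Mod Dia univ_sp (atm Leaf)) l" for v l
        using atm[OF syms_intros(1), of v v] by auto
      then show ?thesis unfolding 1 by (intro gciI)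
    next
      case 2
      show ?thesis unfolding 2
        by (rule gciI) (simp add: atm syms_intros B01 init_config_def del: ext.simps)
    next
      case 3
      have "v \<in> ext ?D (Ex rigid_role (atm (Ch j))) l" for v l
        using atm[OF syms_intros(3)[OF 3(1)], of "v @ [j]" l] by auto
      then show ?thesis unfolding 3 by (intro gciI)
    next
      case 4
      show ?thesis unfolding 4
      proof (rule gciI)
        fix v l assume "v \<in> ext ?D (atm (Ch j)) l"
        then have "v \<in> ext ?D (atm (Ch j)) l'" for l' using atm[OF syms_intros(3)[OF 4(1)]] by simp
        then show "v \<in> ext ?D (Mod Box univ_sp (atm (Ch j))) l" by simp
      qed
    next
      case 5
      show ?thesis unfolding 5
      proof (rule gciI)
        fix v l
        assume "v \<in> ext ?D (Ex rigid_role (Conj (atm (Ch j)) (Conj (atm (St (src j))) (scans (rds j))))) l"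
        then obtain i where i: "v @ [i] \<in> ext ?D (atm (Ch j)) l" "v @ [i] \<in> ext ?D (atm (St (src j))) l"
          "v @ [i] \<in> ext ?D (scans (rds j)) l" by auto
        have "i = j" using i(1) atm[OF syms_intros(3)[OF 5(1)]] by simp
        obtain u c where u: "l = (v @ [i]) @ u" "run w u = Some c" "fst c = src j"
          using i(2) atm[OF syms_intros(2)[OF trs_bound(1)[OF 5(1)]]] by auto
        have "map read_tape (snd c) = rds j"
          using i(3) ext_scans[OF length_trs(1)[OF 5(1)] trs_bound(3)[OF 5(1)] u(2), of "v @ [i]"] u(1)
          by simp
        then show "v \<in> ext ?D (atm (Fire j)) l"
          using u \<open>i = j\<close> 5(1) atm[OF syms_intros(4)[OF 5(1)], of v l] by (simp add: apply_trans_def)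
      qed
    next
      case 6
      show ?thesis unfolding 6
      proof (rule gciI)
        fix v l assume "v \<in> ext ?D (atm (Fire j)) l"
        then show "v \<in> ext ?D (atm (St (tgt j))) l"
          using fire[OF 6(1)] atm[OF syms_intros(2)[OF trs_bound(2)[OF 6(1)]]] by fastforce
      qed
    next
      case 7
      have rs: "length rs = K" "\<And>k. k < K \<Longrightarrow> rs ! k < B"
        using 7(2) by (auto simp: set_n_lists subset_iff)
      show ?thesis unfolding 7
      proof (rule gciI)
        fix v l assume "v \<in> ext ?D (Conj (atm (St 1)) (scans rs)) l"
        then have v: "v \<in> ext ?D (atm (St 1)) l" "v \<in> ext ?D (scans rs) l" by auto
        then obtain u c where u: "l = v @ u" "run w u = Some c" "fst c = 1"
          using atm[OF syms_intros(2)[OF B01(2)]] by auto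
        then have "map read_tape (snd c) = rs" using v(2) ext_scans[OF rs u(2)] by simp
        then have "halted M c" using 7(1) u(3) by (auto simp: halted_def step_def)
        then show "v \<in> ext ?D Bot l" using assms run_reachable[OF u(2)] u(3) by blast
      qed
    qed
  qed
  have shift: "sat_axm ?D x" if x: "x \<in> set (shift_axms z)" for x z
  proof -
    obtain j k where j: "j < J" and k: "k < K" and x: "x \<in> set (shift_axms_for z j k)"
      using x by (auto simp: shift_axms_def)
    obtain a d where ad: "acts j ! k = (a, d)" by fastforce
    have aB: "a < B" using trs_bound(4)[OF j k] ad by simp
    show ?thesis
    proof (cases "z + offset d = 0")
      case True
      then have x: "x = gci (atm (Fire j)) (cell k z a)" using x by (simp add: shift_axms_for_def ad)
      show ?thesis unfolding x
      proof (rule gciI)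
        fix v l assume "v \<in> ext ?D (atm (Fire j)) l"
        from fire[OF j this] obtain u c where "l = v @ j # u" "run w u = Some c" "length (snd c) = K"
          "run w (j # u) = Some (tgt j, map2 act (acts j) (snd c))" by (elim exE conjE)
        then show "v \<in> ext ?D (cell k z a) l"
          using scan_step[OF j _ k, of c z] ad True unfolding ext_cell[OF k aB] by auto
      qed
    next
      case False
      then obtain s where s: "s < B"
        and x: "x = gci (Conj (atm (Fire j)) (Ex rigid_role (cell k (z + offset d) s))) (cell k z s)"
        using x by (auto simp: shift_axms_for_def ad)
      show ?thesis unfolding x
      proof (rule gciI)
        fix v l assume "v \<in> ext ?D (Conj (atm (Fire j)) (Ex rigid_role (cell k (z + offset d) s))) l"
        then obtain i where v: "v \<in> ext ?D (atm (Fire j)) l"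
          and i: "v @ [i] \<in> ext ?D (cell k (z + offset d) s) l" by auto
        from fire[OF j v] obtain u c where u: "l = v @ j # u" "run w u = Some c" "length (snd c) = K"
          "run w (j # u) = Some (tgt j, map2 act (acts j) (snd c))" by (elim exE conjE)
        \<comment> \<open>The cell label forces \<open>v @ [i]\<close> to be a prefix of
          \<open>l = v @ j # u\<close>, hence \<open>i = j\<close>, and the cell belongs to the
          configuration to which \<open>j\<close> is applied.\<close>
        have "scan c k (z + offset d) = s" using i u unfolding ext_cell[OF k s] by auto
        then show "v \<in> ext ?D (cell k z s) l"
          using u scan_step[OF j _ k, of c z] ad False unfolding ext_cell[OF k s] by auto
      qed
    qed
  qed
  have init: "sat_axm ?D x" if x: "x \<in> set (init_axms (word_content w z) z)" for x z
  proof -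
    let ?s = "\<lambda>k. if k = 0 then word_content w z else 0"
    obtain k where k: "k < K" and x: "x = gci (atm Leaf) (cell k z (?s k))"
      using x by (auto simp: init_axms_def)
    have s: "?s k < B" using B_ge_3 by (auto simp: word_content_def)
    have "scan (init_config M w) k z = ?s k"
      using k by (auto simp: scan_def init_config_def word_content_def nth_Cons split: nat.splits)
    then have "run w [] = Some (init_config M w) \<and> scan (init_config M w) k z = ?s k" by simp
    then have "l \<in> ext ?D (cell k z (?s k)) l" for l
      unfolding ext_cell[OF k s] by (metis append_Nil2)
    then show ?thesis unfolding x
      using atm[OF syms_intros(1)] by (intro gciI) (auto simp del: ext.simps)
  qed
  show "sat_kb ?D (set (machine_kb w N))"
    unfolding sat_kb_def set_machine_kb using control shift init by blast
qed

end


section \<open>Printing the knowledge base in polynomial time, and coNP-hardness\<close>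

section \<open>The reduction\<close>

lemma inst_append: "inst m (ts @ ts') = inst m ts @ inst m ts'"
  by (simp add: inst_def)

text \<open>Families of words in which \<open>i\<close> shows up only as blocks of
  \<open>F * i\<close> ones, the form that \<open>template_word\<close> needs.\<close>

definition template :: "nat \<Rightarrow> (nat \<Rightarrow> bool list) \<Rightarrow> bool" where
  "template F g \<longleftrightarrow> (\<exists>ts. \<forall>i. g i = inst (F * i) ts)"

lemma template_const: "template F (\<lambda>_. u)"
  unfolding template_def by (intro exI[of _ "[Bits u]"]) (simp add: inst_def)

lemma template_append:
  assumes "template F g" "template F h"
  shows "template F (\<lambda>i. g i @ h i)"
proof -
  obtain ts ts' where "\<And>i. g i = inst (F * i) ts" "\<And>i. h i = inst (F * i) ts'"
    using assms unfolding template_def by blast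
  then show ?thesis unfolding template_def by (intro exI[of _ "ts @ ts'"]) (simp add: inst_append)
qed

lemma template_concat_map:
  "(\<And>x. x \<in> set xs \<Longrightarrow> template F (\<lambda>i. g x i)) \<Longrightarrow> template F (\<lambda>i. concat (map (\<lambda>x. g x i) xs))"
  by (induction xs) (auto intro: template_const template_append)

text \<open>In unary, the block for \<open>F * i\<close> splits off and a fixed name
  remains.\<close>

lemma template_enc_name: "template F (\<lambda>i. enc_name (a + F * (i + c)))"
proof -
  have "enc_name (a + F * (i + c)) = inst (F * i) [Count, Bits (enc_name (a + F * c))]" for i
    by (simp add: enc_name_def inst_def algebra_simps flip: replicate_add)
  then show ?thesis unfolding template_def by blast
qed

text \<open>Dropping the end marker of \<open>enc_axms\<close> makes the code of an append the
  append of the codes.\<close>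

definition enc_list :: "axm list \<Rightarrow> bool list" where
  "enc_list \<alpha>s = concat (map (\<lambda>\<alpha>. [True] @ enc_axm \<alpha>) \<alpha>s)"

lemma enc_list_append: "enc_list (\<alpha>s @ \<beta>s) = enc_list \<alpha>s @ enc_list \<beta>s"
  by (simp add: enc_list_def)

lemma enc_list_concat: "enc_list (concat \<alpha>ss) = concat (map enc_list \<alpha>ss)"
  by (induction \<alpha>ss) (auto simp: enc_list_def)

lemma enc_axms_enc_list: "enc_axms \<alpha>s = enc_list \<alpha>s @ [False]"
  by (induction \<alpha>s) (auto simp: enc_list_def)

context wf_machine
begin

lemma template_gci:
  assumes "template F (\<lambda>i. enc_concept (C i))" "template F (\<lambda>i. enc_concept (E i))"
  shows "template F (\<lambda>i. enc_axm (gci (C i) (E i)))"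
  unfolding enc_axm.simps using assms by (intro template_append template_const)

lemma template_Conj:
  assumes "template F (\<lambda>i. enc_concept (C i))" "template F (\<lambda>i. enc_concept (E i))"
  shows "template F (\<lambda>i. enc_concept (Conj (C i) (E i)))"
  unfolding enc_concept.simps using assms by (intro template_append template_const)

lemma template_Ex:
  assumes "template F (\<lambda>i. enc_concept (C i))"
  shows "template F (\<lambda>i. enc_concept (Ex r (C i)))"
  unfolding enc_concept.simps using assms by (intro template_append template_const)

text \<open>The name of a cell depends on the side of the head on which it lies. Hence only distances that
  stay on one side yield a template, and this is why the shift axioms for the distances \<open>-1\<close>, \<open>0\<close> and
  \<open>1\<close>, where a head move may change the side, are among the fixed ones.\<close>

definition moving :: "nat \<Rightarrow> (nat \<Rightarrow> int) \<Rightarrow> bool" where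
  "moving m z \<longleftrightarrow> (\<exists>b c. m \<le> c \<and> (b \<or> 1 \<le> c) \<and>
     (\<forall>i. z i = (if b then int (i + c) else - int (i + c))))"

lemma template_cell:
  assumes "moving 0 z"
  shows "template F (\<lambda>i. enc_concept (cell k (z i) s))"
proof -
  obtain b c where bc: "b \<or> 1 \<le> c" "\<And>i. z i = (if b then int (i + c) else - int (i + c))"
    using assms unfolding moving_def by blast
  then have "(0 \<le> z i) = b" "nat \<bar>z i\<bar> = i + c" for i
    by (cases b; simp)+
  then show ?thesis
    unfolding cell_def nm_def enc_concept.simps
    by (simp only:) (intro template_append template_const template_enc_name)
qed

text \<open>A head move costs one unit of margin. As at least 1 remains, zero is not reached and the
  side stays the same.\<close>

lemma moving_offset:
  assumes "moving (Suc m) z" "1 \<le> m"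
  shows "moving m (\<lambda>i. z i + offset d)"
proof -
  obtain b c where bc: "Suc m \<le> c" "\<And>i. z i = (if b then int (i + c) else - int (i + c))"
    using assms unfolding moving_def by blast
  define c' where "c' = nat (int c + (if b then offset d else - offset d))"
  have "\<bar>offset d\<bar> \<le> 1" by (cases d) auto
  then have "m \<le> c'" "z i + offset d = (if b then int (i + c') else - int (i + c'))" for i
    using bc unfolding c'_def by (cases b; auto)+
  then show ?thesis
    using assms(2) unfolding moving_def by (intro exI[of _ b] exI[of _ c']) auto
qed

lemma moving_mono:
  assumes "moving m z" "m' \<le> m"
  shows "moving m' z"
proof -
  obtain b c where "m \<le> c" "b \<or> 1 \<le> c" "\<And>i. z i = (if b then int (i + c) else - int (i + c))"
    using assms unfolding moving_def by blast
  then show ?thesis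
    using assms(2) unfolding moving_def by (intro exI[of _ b] exI[of _ c]) auto
qed

text \<open>With margin 2, \<open>z i + offset d\<close> is never 0, so the same branch of
  \<open>shift_axms_for\<close> is taken for all \<open>i\<close>.\<close>

lemma template_shift_axms:
  assumes z: "moving 2 z"
  shows "template F (\<lambda>i. enc_list (shift_axms (z i)))"
proof -
  have "template F (\<lambda>i. enc_list (shift_axms_for (z i) j k))" for j k
  proof -
    obtain a d where ad: "acts j ! k = (a, d)" by fastforce
    have nz: "z i + offset d \<noteq> 0" for i
    proof -
      obtain b c where "2 \<le> c" "z i = (if b then int (i + c) else - int (i + c))"
        using z unfolding moving_def by blast
      then show ?thesis by (cases b; cases d) auto
    qed
    have "moving 0 z" using z by (rule moving_mono) simp
    moreover have "moving 0 (\<lambda>i. z i + offset d)"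
      using moving_mono[OF moving_offset[of 1 z d]] z by (simp add: numeral_2_eq_2)
    ultimately show ?thesis
      unfolding shift_axms_for_def ad enc_list_def prod.case Let_def if_not_P[OF nz] map_map comp_def
      by (intro template_concat_map template_append template_const template_gci template_Conj
          template_Ex template_cell)
  qed
  then show ?thesis
    unfolding shift_axms_def enc_list_concat map_map comp_def
    by (intro template_concat_map)
qed

lemma template_init_axms:
  assumes z: "moving 0 z"
  shows "template F (\<lambda>i. enc_list (init_axms s (z i)))"
  unfolding init_axms_def enc_list_def map_map comp_def
  by (intro template_concat_map template_append template_const template_gci template_cell z)

lemma template_position_axms: "template F (\<lambda>i. enc_list (position_axms s i))"
proof -
  have pos: "moving m (\<lambda>i. int (i + m))" for m
    unfolding moving_def by (intro exI[of _ True] exI[of _ m]) simp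
  have neg: "moving m (\<lambda>i. - int (i + m))" if "1 \<le> m" for m
    using that unfolding moving_def by (intro exI[of _ False] exI[of _ m]) simp
  have "moving 0 (\<lambda>i. int i)" using pos[of 0] by simp
  moreover have "moving 0 (\<lambda>i. - int (i + 1))" using moving_mono[OF neg[of 1]] by simp
  moreover have "moving 2 (\<lambda>i. int (i + 2))" by (rule pos)
  moreover have "moving 2 (\<lambda>i. - int (i + 2))" by (rule neg) simp
  ultimately show ?thesis
    unfolding position_axms_def enc_list_append
    by (intro template_append template_init_axms template_shift_axms)
qed

lemma polytime_computable_machine_kb:
  "polytime_computable (\<lambda>w. enc_axms (machine_kb w (length w + (length w + 2) ^ k)))"
proof -
  have "\<exists>g. \<forall>s. \<forall>i. enc_list (position_axms s i) = inst (F * i) (g s)"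
    using template_position_axms unfolding template_def by (intro choice) blast
  then obtain g where g: "\<And>s i. enc_list (position_axms s i) = inst (F * i) (g s)" by blast
  have "enc_axms (machine_kb w N) = template_word F (enc_list fixed_axms) g w N @ [False]" for w N
    by (simp add: enc_axms_enc_list machine_kb_def enc_list_append enc_list_concat comp_def g
        template_word_def)
  then show ?thesis using polytime_computable_template by simp
qed

end

text \<open>The base is at least 2, so the constant \<open>a\<close> is absorbed through
  \<open>a < 2 ^ a\<close>, and each factor \<open>n\<close> by one more power.\<close>

lemma poly_less_power: "\<exists>k. \<forall>n. poly p n < (n + 2) ^ k" for p :: "nat poly"
proof (induction p)
  case 0
  have "\<forall>n :: nat. poly 0 n < (n + 2) ^ 0" by simp
  then show ?case by blast
next
  case (pCons a p)
  then obtain k where k: "\<And>n. poly p n < (n + 2) ^ k" by blast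
  have "poly (pCons a p) n < (n + 2) ^ (a + Suc k)" for n
  proof -
    have "a < 2 ^ a" by simp
    also have "\<dots> \<le> (n + 2) ^ a" by (simp add: power_mono)
    finally have a: "a + 1 \<le> (n + 2) ^ a" by simp
    let ?y = "(n + 2) ^ k"
    have "n * poly p n \<le> n * ?y" using k[of n] by (intro mult_left_mono) auto
    then have "poly (pCons a p) n \<le> a + n * ?y" by simp
    also have "a + n * ?y < a * ?y + n * ?y + 2 * ?y"
    proof -
      have "1 \<le> ?y" by simp
      then have "a * 1 \<le> a * ?y" by (rule mult_left_mono) simp
      then show ?thesis using \<open>1 \<le> ?y\<close> by linarith
    qed
    also have "\<dots> \<le> (a + 1) * ((n + 2) * ?y)" by (simp add: algebra_simps)
    also have "\<dots> \<le> (n + 2) ^ a * ((n + 2) * ?y)" using a by (rule mult_right_mono) simp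
    finally show ?thesis by (simp only: power_add power_Suc)
  qed
  then show ?case by blast
qed

theorem mainTheorem3:
  shows "coNP_hard RIGID_EL_SAT"
  unfolding coNP_hard_def
proof
  fix L assume "L \<in> coNP"
  then obtain M and p :: "nat poly" where M: "wf_tm M" and dec: "nd_decides_in M (- L) (poly p)"
    unfolding coNP_def NP_def by blast
  interpret wf_machine M using M by unfold_locales
  obtain k where k: "\<And>n. poly p n < (n + 2) ^ k" using poly_less_power by blast
  \<comment> \<open>The window has to exceed the time bound \<open>poly p\<close>; its size has the
    shape that the printing program handles, one round per input symbol and then
    \<open>(length w + 2) ^ k\<close> more.\<close>
  let ?N = "\<lambda>w. length w + (length w + 2) ^ k"
  let ?f = "\<lambda>w. enc_axms (machine_kb w (?N w))"
  have "w \<in> L \<longleftrightarrow> ?f w \<in> RIGID_EL_SAT" for w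
  proof -
    have acc: "w \<notin> L \<longleftrightarrow> (\<exists>c. (step M)\<^sup>*\<^sup>* (init_config M w) c \<and> halted M c \<and> fst c = 1)"
      using dec unfolding nd_decides_in_def by auto
    have "\<not> satisfiable (set (machine_kb w (?N w)))" if rej: "w \<notin> L"
    proof -
      obtain c where c: "(step M)\<^sup>*\<^sup>* (init_config M w) c" "halted M c" "fst c = 1"
        using rej unfolding acc by blast
      obtain t where t: "(step M ^^ t) (init_config M w) c"
        using c(1) unfolding rtranclp_power by (elim exE)
      then have "t \<le> poly p (length w)" using dec unfolding nd_decides_in_def by blast
      then have "t < ?N w" using k[of "length w"] by linarith
      then show ?thesis using unsatisfiable_if_accepting t c by blast
    qed
    moreover have "satisfiable (set (machine_kb w (?N w)))" if "w \<in> L"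
      using that acc by (intro satisfiable_if_not_accepting) blast
    \<comment> \<open>Membership asks for some satisfiable list with this code; by injectivity it is
      this very list.\<close>
    moreover have "?f w \<in> RIGID_EL_SAT \<longleftrightarrow> satisfiable (set (machine_kb w (?N w)))"
      unfolding RIGID_EL_SAT_def using inj_enc_axms by (auto dest: injD)
    ultimately show ?thesis by blast
  qed
  then show "polytime_reducible L RIGID_EL_SAT"
    unfolding polytime_reducible_def using polytime_computable_machine_kb[of k] by blast
qed

end
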